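(* Let $T$ be a Morse–Smale diffeomorphism of period one on a one-dimensional compact manifold $M$ ($M=\mathbb T=\mathbb R/\mathbb Z$ or $M=[0,1]$), let $(\bar\Omega,\bar{\mathbb P})=(\mathcal A^{\mathbb Z},p^{\mathbb Z})$ with $\tau:\bar\Omega\to\bar\Omega$ the two-sided shift, and let $\Psi$ be a $\mathbb Z$-valued one-step random variable, $\Psi(\omega)=\Psi(\omega_0)$. Consider the one-step skew product $$\bar F_{T^\Psi}:\bar\Omega\times M\to\bar\Omega\times M,\qquad \bar F_{T^\Psi}(\omega,x)=(\tau(\omega),T^{\Psi(\omega_0)}(x)).$$ If $\mathbb E[\Psi]=0$ and $0<\mathbb E[\Psi^2]<\infty$, then $\bar F_{T^\Psi}$ exhibits historical behavior for $(\bar{\mathbb P}\times\mathrm{Leb})$-a.e. point, and for every pair of consecutive fixed points $p$ and $q$ of $T$, $$\mathcal L(\omega,x)=\{\lambda\delta_p+(1-\lambda)\delta_q:\lambda\in[0,1]\}\quad\text{for }\bar{\mathbb P}\text{-a.e. }\omega\in\bar\Omega\text{ and }x\in(p,q).$$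
   Context: $\mathcal A$ is an at most countable alphabet with the discrete $\sigma$-algebra, and $p$ (as the marginal of $\bar{\mathbb P}$) is a probability measure on $\mathcal A$ with full support. $T$ is Morse–Smale of period one if it has a non-empty set of periodic points consisting solely of sinks and sources of period one (fixed points). Writing $f_\omega=T^{\Psi(\omega_0)}$, let $f^0_\omega=\mathrm{id}$ and $f^n_\omega=f_{\tau^{n-1}(\omega)}\circ\dots\circ f_\omega$ for $n\ge1$. $\mathrm{Leb}$ is Lebesgue measure on $M$. Historical behavior for $(\bar{\mathbb P}\times\mathrm{Leb})$-a.e. point: for $(\bar{\mathbb P}\times\mathrm{Leb})$-a.e. $(\omega,x)$ there is a continuous $\varphi:M\to\mathbb R$ such that $\lim_{n\to\infty}\frac1n\sum_{j=0}^{n-1}\varphi(f^j_\omega(x))$ does not exist. $\mathcal L(\omega,x)$ is the set of weak$^*$ accumulation points of $\frac1n\sum_{j=0}^{n-1}\delta_{f^j_\omega(x)}$, $n\ge1$. *)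

theory Defs
  imports "HOL-Probability.Probability"
begin

section \<open>The manifolds \<open>\<real>/\<int>\<close> and \<open>[0,1]\<close>\<close>

text \<open>
  Both manifolds are subsets of the complex plane: \<open>\<real>/\<int>\<close> is the unit circle, with
  quotient map \<open>t \<mapsto> exp (2 \<pi> i t)\<close>, and \<open>[0,1]\<close> is the unit segment of the real axis.
  In either case \<open>param M\<close>, on the interval \<open>pdom M\<close>, is the universal covering. The smooth
  structure and Lebesgue measure are those transported from the real line by \<open>param M\<close>.
\<close>

datatype one_manifold = Circle | Interval

fun pdom :: "one_manifold \<Rightarrow> real set" where
  "pdom Circle = UNIV"
| "pdom Interval = {0..1}"

fun param :: "one_manifold \<Rightarrow> real \<Rightarrow> complex" where
  "param Circle t = cis (2 * pi * t)"
| "param Interval t = complex_of_real t"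

definition pts :: "one_manifold \<Rightarrow> complex set" where
  "pts M = param M ` pdom M"

lemma pts_Circle: "pts Circle = sphere 0 1"
proof
  show "pts Circle \<subseteq> sphere 0 1"
    by (auto simp: pts_def)
  show "sphere 0 1 \<subseteq> pts Circle"
  proof
    fix z :: complex assume "z \<in> sphere 0 1"
    then have "z = cis (2 * pi * (Arg z / (2 * pi)))"
      by simp (metis rcis_cmod_Arg rcis_def mult_1 of_real_1)
    then show "z \<in> pts Circle"
      unfolding pts_def by (metis param.simps(1) pdom.simps(1) rangeI)
  qed
qed

lemma param_Circle_eq_iff: "param Circle s = param Circle t \<longleftrightarrow> s - t \<in> \<int>"
proof -
  have "param Circle s = param Circle t \<longleftrightarrow> cis (2 * pi * (s - t)) = 1"
    by (simp add: right_diff_distrib flip: cis_divide)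
  also have "\<dots> \<longleftrightarrow> (\<exists>n::int. 2 * pi * (s - t) = of_int n * 2 * pi)"
  proof -
    have "cis x = 1 \<longleftrightarrow> cos x = 1" for x
    proof
      assume "cos x = 1"
      then show "cis x = 1"
        using sin_cos_squared_add[of x] by (simp add: complex_eq_iff)
    qed (simp add: complex_eq_iff)
    then show ?thesis
      by (simp only: cos_one_2pi_int)
  qed
  also have "\<dots> \<longleftrightarrow> s - t \<in> \<int>"
  proof -
    have "2 * pi * (s - t) = of_int n * 2 * pi \<longleftrightarrow> s - t = of_int n" for n
      by auto
    then show ?thesis
      by (auto elim: Ints_cases)
  qed
  finally show ?thesis .
qed

abbreviation borel_on :: "one_manifold \<Rightarrow> complex measure" where
  "borel_on M \<equiv> restrict_space borel (pts M)"

definition Leb :: "one_manifold \<Rightarrow> complex measure" where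
  "Leb M = distr (restrict_space lborel {0..1}) (borel_on M) (param M)"

lemma measurable_param: "param M \<in> measurable (restrict_space lborel {0..1}) (borel_on M)"
proof (rule measurable_restrict_space2)
  show "param M \<in> space (restrict_space lborel {0..1}) \<rightarrow> pts M"
    by (cases M) (auto simp: pts_def space_restrict_space)
  have "continuous_on UNIV (param M)"
    by (cases M) (auto simp: cis_conv_exp intro!: continuous_intros)
  then have "param M \<in> borel_measurable borel"
    by (rule borel_measurable_continuous_onI)
  then show "param M \<in> borel_measurable (restrict_space lborel {0..1})"
    by (intro measurable_restrict_space1) simp
qed


section \<open>Morse--Smale diffeomorphisms of period one\<close>

definition lift_of :: "one_manifold \<Rightarrow> (complex \<Rightarrow> complex) \<Rightarrow> (real \<Rightarrow> real) \<Rightarrow> bool" where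
  "lift_of M T g \<longleftrightarrow> g ` pdom M \<subseteq> pdom M \<and> (\<forall>t\<in>pdom M. param M (g t) = T (param M t))"

text \<open>Every continuous self-map of \<open>M\<close> has a continuous lift, since \<open>pdom M\<close> is simply
  connected. On the segment the only lift is the map itself, and derivatives at the end points
  are one-sided.\<close>

definition C1_map :: "one_manifold \<Rightarrow> (complex \<Rightarrow> complex) \<Rightarrow> bool" where
  "C1_map M T \<longleftrightarrow> (\<exists>g g'. lift_of M T g \<and>
     (\<forall>t\<in>pdom M. (g has_real_derivative g' t) (at t within pdom M)) \<and>
     continuous_on (pdom M) g')"

definition diffeomorphism :: "one_manifold \<Rightarrow> (complex \<Rightarrow> complex) \<Rightarrow> bool" where
  "diffeomorphism M T \<longleftrightarrow>
     bij_betw T (pts M) (pts M) \<and> C1_map M T \<and> C1_map M (inv_into (pts M) T)"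

text \<open>Different lifts, and different base points above \<open>x\<close>, give the same derivative.\<close>

definition has_deriv_at :: "one_manifold \<Rightarrow> (complex \<Rightarrow> complex) \<Rightarrow> real \<Rightarrow> complex \<Rightarrow> bool" where
  "has_deriv_at M T d x \<longleftrightarrow> (\<exists>g. \<exists>t\<in>pdom M. lift_of M T g \<and> param M t = x \<and>
     (g has_real_derivative d) (at t within pdom M))"

definition fixed_point :: "one_manifold \<Rightarrow> (complex \<Rightarrow> complex) \<Rightarrow> complex \<Rightarrow> bool" where
  "fixed_point M T x \<longleftrightarrow> x \<in> pts M \<and> T x = x"

definition periodic_point :: "one_manifold \<Rightarrow> (complex \<Rightarrow> complex) \<Rightarrow> complex \<Rightarrow> bool" where
  "periodic_point M T x \<longleftrightarrow> x \<in> pts M \<and> (\<exists>n\<ge>1. (T ^^ n) x = x)"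

text \<open>Sinks and sources are hyperbolic, as is usual for Morse--Smale systems.\<close>

definition fixed_sink :: "one_manifold \<Rightarrow> (complex \<Rightarrow> complex) \<Rightarrow> complex \<Rightarrow> bool" where
  "fixed_sink M T x \<longleftrightarrow> fixed_point M T x \<and> (\<exists>d. has_deriv_at M T d x \<and> \<bar>d\<bar> < 1)"

definition fixed_source :: "one_manifold \<Rightarrow> (complex \<Rightarrow> complex) \<Rightarrow> complex \<Rightarrow> bool" where
  "fixed_source M T x \<longleftrightarrow> fixed_point M T x \<and> (\<exists>d. has_deriv_at M T d x \<and> \<bar>d\<bar> > 1)"

definition morse_smale_period_one :: "one_manifold \<Rightarrow> (complex \<Rightarrow> complex) \<Rightarrow> bool" where
  "morse_smale_period_one M T \<longleftrightarrow> diffeomorphism M T \<and> (\<exists>x. periodic_point M T x) \<and>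
     (\<forall>x. periodic_point M T x \<longrightarrow> fixed_sink M T x \<or> fixed_source M T x)"

text \<open>On the circle, \<open>open_arc M s t\<close> is the arc run through counterclockwise from \<open>param M s\<close> to
  \<open>param M t\<close>. The second definition says that \<open>param M s\<close> and \<open>param M t\<close> are consecutive
  fixed points and that \<open>open_arc M s t\<close> is the open interval between them.\<close>

definition open_arc :: "one_manifold \<Rightarrow> real \<Rightarrow> real \<Rightarrow> complex set" where
  "open_arc M s t = param M ` {s<..<t}"

definition consecutive_fixed :: "one_manifold \<Rightarrow> (complex \<Rightarrow> complex) \<Rightarrow> real \<Rightarrow> real \<Rightarrow> bool" where
  "consecutive_fixed M T s t \<longleftrightarrow> s \<in> pdom M \<and> t \<in> pdom M \<and> s < t \<and>
     fixed_point M T (param M s) \<and> fixed_point M T (param M t) \<and>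
     (\<forall>x\<in>open_arc M s t. \<not> fixed_point M T x)"


section \<open>The skew product\<close>

definition bernoulli_measure :: "'a pmf \<Rightarrow> (int \<Rightarrow> 'a) measure" where
  "bernoulli_measure P = Pi\<^sub>M UNIV (\<lambda>_. measure_pmf P)"

definition shift :: "(int \<Rightarrow> 'a) \<Rightarrow> (int \<Rightarrow> 'a)" where
  "shift \<omega> = (\<lambda>i. \<omega> (i + 1))"

definition int_iterate :: "one_manifold \<Rightarrow> (complex \<Rightarrow> complex) \<Rightarrow> int \<Rightarrow> complex \<Rightarrow> complex" where
  "int_iterate M T k = (if k \<ge> 0 then T ^^ nat k else inv_into (pts M) T ^^ nat (- k))"

definition fiber_map ::
    "one_manifold \<Rightarrow> (complex \<Rightarrow> complex) \<Rightarrow> ('a \<Rightarrow> int) \<Rightarrow> (int \<Rightarrow> 'a) \<Rightarrow> complex \<Rightarrow> complex" where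
  "fiber_map M T \<Psi> \<omega> = int_iterate M T (\<Psi> (\<omega> 0))"

definition skew_product ::
    "one_manifold \<Rightarrow> (complex \<Rightarrow> complex) \<Rightarrow> ('a \<Rightarrow> int) \<Rightarrow>
     (int \<Rightarrow> 'a) \<times> complex \<Rightarrow> (int \<Rightarrow> 'a) \<times> complex" where
  "skew_product M T \<Psi> = (\<lambda>(\<omega>, x). (shift \<omega>, fiber_map M T \<Psi> \<omega> x))"

primrec fiber_iterate ::
    "one_manifold \<Rightarrow> (complex \<Rightarrow> complex) \<Rightarrow> ('a \<Rightarrow> int) \<Rightarrow> nat \<Rightarrow> (int \<Rightarrow> 'a) \<Rightarrow>
     complex \<Rightarrow> complex" where
  "fiber_iterate M T \<Psi> 0 \<omega> = id"
| "fiber_iterate M T \<Psi> (Suc n) \<omega> =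
     fiber_map M T \<Psi> ((shift ^^ n) \<omega>) \<circ> fiber_iterate M T \<Psi> n \<omega>"

lemma skew_product_iterate:
  "(skew_product M T \<Psi> ^^ n) (\<omega>, x) = ((shift ^^ n) \<omega>, fiber_iterate M T \<Psi> n \<omega> x)"
  by (induction n) (simp_all add: skew_product_def)


section \<open>Historical behavior and limits of empirical measures\<close>

definition historical_at ::
    "one_manifold \<Rightarrow> (complex \<Rightarrow> complex) \<Rightarrow> ('a \<Rightarrow> int) \<Rightarrow> (int \<Rightarrow> 'a) \<Rightarrow> complex \<Rightarrow> bool" where
  "historical_at M T \<Psi> \<omega> x \<longleftrightarrow> (\<exists>\<phi> :: complex \<Rightarrow> real. continuous_on (pts M) \<phi> \<and>
     \<not> convergent (\<lambda>n. (1 / real n) * (\<Sum>j<n. \<phi> (fiber_iterate M T \<Psi> j \<omega> x))))"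

definition dirac :: "one_manifold \<Rightarrow> complex \<Rightarrow> complex measure" where
  "dirac M x = return (borel_on M) x"

definition convex_comb :: "real \<Rightarrow> 'b measure \<Rightarrow> 'b measure \<Rightarrow> 'b measure" where
  "convex_comb l \<mu> \<nu> = measure_of (space \<mu>) (sets \<mu>)
     (\<lambda>A. ennreal l * emeasure \<mu> A + ennreal (1 - l) * emeasure \<nu> A)"

lemma emeasure_convex_comb:
  assumes "sets \<nu> = sets \<mu>" "A \<in> sets \<mu>"
  shows "emeasure (convex_comb l \<mu> \<nu>) A = ennreal l * emeasure \<mu> A + ennreal (1 - l) * emeasure \<nu> A"
proof (rule emeasure_measure_of[OF convex_comb_def])
  show "sets \<mu> \<subseteq> Pow (space \<mu>)"
    by (rule sets.space_closed)
  show "A \<in> sets (convex_comb l \<mu> \<nu>)"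
    using assms by (simp add: convex_comb_def)
  let ?f = "\<lambda>A. ennreal l * emeasure \<mu> A + ennreal (1 - l) * emeasure \<nu> A"
  show "positive (sets (convex_comb l \<mu> \<nu>)) ?f"
    by (simp add: positive_def)
  show "countably_additive (sets (convex_comb l \<mu> \<nu>)) ?f"
  proof (rule countably_additiveI)
    fix B :: "nat \<Rightarrow> _" assume "range B \<subseteq> sets (convex_comb l \<mu> \<nu>)" "disjoint_family B"
    then have "range B \<subseteq> sets \<mu>" "range B \<subseteq> sets \<nu>" "disjoint_family B"
      using assms by (simp_all add: convex_comb_def)
    then show "(\<Sum>i. ?f (B i)) = ?f (\<Union>i. B i)"
      by (simp add: suminf_add[symmetric] ennreal_suminf_cmult suminf_emeasure)
  qed
qed

definition empirical_measure :: "one_manifold \<Rightarrow> (nat \<Rightarrow> complex) \<Rightarrow> nat \<Rightarrow> complex measure" where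
  "empirical_measure M y n = measure_of (pts M) (sets (borel_on M))
     (\<lambda>A. ennreal (1 / real n) * (\<Sum>j<n. emeasure (dirac M (y j)) A))"

lemma emeasure_empirical_measure:
  assumes "A \<in> sets (borel_on M)"
  shows "emeasure (empirical_measure M y n) A =
    ennreal (1 / real n) * (\<Sum>j<n. emeasure (dirac M (y j)) A)"
proof (rule emeasure_measure_of[OF empirical_measure_def])
  have sub: "sets (borel_on M) \<subseteq> Pow (pts M)"
    using sets.space_closed[of "borel_on M"] by (simp add: space_restrict_space)
  then show "sets (borel_on M) \<subseteq> Pow (pts M)" .
  have alg: "sigma_algebra (pts M) (sets (borel_on M))"
    using sets.sigma_algebra_axioms[of "borel_on M"] by (simp add: space_restrict_space)
  have eq: "sets (empirical_measure M y n) = sets (borel_on M)"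
    unfolding empirical_measure_def using sub alg
    by (simp add: sets_measure_of sigma_algebra.sigma_sets_eq)
  show "A \<in> sets (empirical_measure M y n)"
    using assms eq by simp
  let ?f = "\<lambda>A. ennreal (1 / real n) * (\<Sum>j<n. emeasure (dirac M (y j)) A)"
  show "positive (sets (empirical_measure M y n)) ?f"
    by (simp add: positive_def)
  show "countably_additive (sets (empirical_measure M y n)) ?f"
  proof (rule countably_additiveI)
    fix B :: "nat \<Rightarrow> _" assume "range B \<subseteq> sets (empirical_measure M y n)" "disjoint_family B"
    then have "range B \<subseteq> sets (dirac M x)" "disjoint_family B" for x
      using eq by (simp_all add: dirac_def)
    then show "(\<Sum>i. ?f (B i)) = ?f (\<Union>i. B i)"
      by (simp add: ennreal_suminf_cmult suminf_sum suminf_emeasure)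
  qed
qed

definition prob_measures :: "one_manifold \<Rightarrow> complex measure set" where
  "prob_measures M = {\<mu>. sets \<mu> = sets (borel_on M) \<and> prob_space \<mu>}"

definition weak_star_topology :: "one_manifold \<Rightarrow> complex measure topology" where
  "weak_star_topology M = topology_generated_by
     {{\<mu> \<in> prob_measures M. (\<integral>x. \<phi> x \<partial>\<mu>) \<in> U} | (\<phi> :: complex \<Rightarrow> real) U.
        continuous_on (pts M) \<phi> \<and> open U}"

lemma topspace_weak_star: "topspace (weak_star_topology M) = prob_measures M"
proof -
  let ?S = "{{\<mu> \<in> prob_measures M. (\<integral>x. \<phi> x \<partial>\<mu>) \<in> U} | (\<phi> :: complex \<Rightarrow> real) U.
        continuous_on (pts M) \<phi> \<and> open U}"
  have "prob_measures M \<in> ?S"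
    by (rule CollectI, rule exI[of _ "\<lambda>_. 0"], rule exI[of _ UNIV]) auto
  then have "\<Union>?S = prob_measures M"
    by blast
  then show ?thesis
    by (simp add: weak_star_topology_def)
qed

definition limit_measures ::
    "one_manifold \<Rightarrow> (complex \<Rightarrow> complex) \<Rightarrow> ('a \<Rightarrow> int) \<Rightarrow> (int \<Rightarrow> 'a) \<Rightarrow> complex \<Rightarrow>
     complex measure set" where
  "limit_measures M T \<Psi> \<omega> x = {\<mu> \<in> topspace (weak_star_topology M).
     \<forall>U. openin (weak_star_topology M) U \<and> \<mu> \<in> U \<longrightarrow>
       (\<exists>\<^sub>F n in sequentially.
          empirical_measure M (\<lambda>j. fiber_iterate M T \<Psi> j \<omega> x) n \<in> U)}"

end

theory Submission
  imports Defs
begin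

text \<open>
The fibre maps are integer powers of one map, so the orbit of \<open>x\<close> is \<open>T^(S\<^sub>n) x\<close>, where \<open>S\<^sub>n\<close> is the
random walk on \<open>\<int>\<close> with steps \<open>\<Psi> (\<omega> n)\<close>. If \<open>x\<close> lies between the consecutive fixed points \<open>p\<close> and
\<open>q\<close>, then (after exchanging \<open>p\<close> and \<open>q\<close> if necessary) \<open>T\<^sup>k x\<close> tends to \<open>q\<close> as \<open>k \<rightarrow> \<infinity>\<close> and to \<open>p\<close> as
\<open>k \<rightarrow> -\<infinity>\<close>. Everything is therefore decided by how the walk distributes its time among the positive
integers, the negative integers and the individual sites.

Almost surely each single site receives a vanishing fraction of the time, while the fraction of time
spent among the positive integers has upper limit 1 and lower limit 0 (a weak form of the arcsine
law). A path with these properties is called \<open>oscillating\<close> below. For it, the time average of a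
continuous \<open>\<phi>\<close> along the orbit of \<open>x\<close> differs from \<open>\<phi> p + A\<^sub>n (\<phi> q - \<phi> p)\<close> by a null sequence, where
\<open>A\<^sub>n\<close> is the positive fraction. Since \<open>A\<^sub>n\<close> moves by at most \<open>1/n\<close> in one step, it accumulates at
every point of \<open>[0,1]\<close>, and the limit points of the empirical measures are exactly the convex
combinations of \<open>\<delta>\<^sub>p\<close> and \<open>\<delta>\<^sub>q\<close>; as \<open>p \<noteq> q\<close>, the averages of the distance to \<open>p\<close> diverge.

The probabilistic input rests on the central limit theorem.

\<^item> Null sites (\<open>eventually_visits_le\<close>): by the central limit theorem no site carries much mass at
large times, uniformly over sites. Hence over a long block of times the expected fraction of visits to
a site is small, wherever the walk starts. Because this holds uniformly in the starting point, the
exponential moments of the number of visits multiply over consecutive blocks, which gives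
exponentially small probabilities for a positive fraction of visits, and the Borel--Cantelli lemma
applies.

\<^item> Long positive stretches (\<open>frequently_visits_positive\<close>): with a probability bounded away from 0 the
walk is far above the origin after a small part of a time interval and then, by Chebyshev's
inequality, positive for most of the rest. So the event that this happens infinitely often has positive
probability; it is invariant under the shift, and Kolmogorov's law makes it almost sure.

On the dynamical side, \<open>T\<close> is studied through a lift \<open>g\<close> to the line, and in fact through \<open>g \<circ> g\<close>, a
lift of \<open>T \<circ> T\<close>, which is increasing whether or not \<open>T\<close> preserves orientation. Points fixed by
\<open>T \<circ> T\<close> are periodic, hence fixed by \<open>T\<close>, so \<open>g \<circ> g\<close> has no fixed points between consecutive fixed
points of \<open>T\<close> and its orbits there run monotonically from one end to the other. Hyperbolicity enters
twice: it makes the fixed points isolated, so that Lebesgue-almost every point lies between two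
consecutive ones, and it excludes a circle map with a single fixed point, for which \<open>p = q\<close>.
\<close>

section \<open>Integer paths and the time they spend in a set\<close>

definition walk :: "(nat \<Rightarrow> int) \<Rightarrow> nat \<Rightarrow> int" where
  "walk \<omega> n = (\<Sum>i<n. \<omega> i)"

definition visits :: "(nat \<Rightarrow> int) \<Rightarrow> int set \<Rightarrow> nat \<Rightarrow> nat" where
  "visits S A n = card {j. j < n \<and> S j \<in> A}"

lemma walk_0 [simp]: "walk \<omega> 0 = 0"
  by (simp add: walk_def)

lemma visits_0 [simp]: "visits S A 0 = 0"
  by (simp add: visits_def)

lemma visits_eq_sum: "real (visits S A n) = (\<Sum>j<n. indicator A (S j))"
proof -
  have "{j. j < n \<and> S j \<in> A} = {..<n} \<inter> {j. S j \<in> A}"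
    by auto
  then show ?thesis
    by (simp add: visits_def indicator_def sum.If_cases)
qed

lemma visits_le: "visits S A n \<le> n"
  using card_mono[of "{..<n}" "{j. j < n \<and> S j \<in> A}"] by (auto simp: visits_def)

lemma visits_mono: "A \<subseteq> B \<Longrightarrow> n \<le> m \<Longrightarrow> visits S A n \<le> visits S B m"
  unfolding visits_def by (intro card_mono) auto

lemma visits_add: "visits S A (m + n) = visits S A m + visits (\<lambda>j. S (m + j)) A n"
proof -
  have "{j. j < m + n \<and> S j \<in> A} =
      {j. j < m \<and> S j \<in> A} \<union> (+) m ` {j. j < n \<and> S (m + j) \<in> A}"
  proof (intro equalityI subsetI)
    fix j assume "j \<in> {j. j < m + n \<and> S j \<in> A}"
    then show "j \<in> {j. j < m \<and> S j \<in> A} \<union> (+) m ` {j. j < n \<and> S (m + j) \<in> A}"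
      by (cases "j < m") (auto simp: image_iff intro!: exI[of _ "j - m"])
  qed auto
  moreover have "card ({j. j < m \<and> S j \<in> A} \<union> (+) m ` {j. j < n \<and> S (m + j) \<in> A})
      = card {j. j < m \<and> S j \<in> A} + card ((+) m ` {j. j < n \<and> S (m + j) \<in> A})"
    by (intro card_Un_disjoint) auto
  ultimately show ?thesis
    by (simp add: visits_def card_image)
qed

lemma visits_shift_space: "visits (\<lambda>j. a + S j) A n = visits S {k. a + k \<in> A} n"
  by (simp add: visits_def)

lemma visits_Un_disjoint: "A \<inter> B = {} \<Longrightarrow> visits S (A \<union> B) n = visits S A n + visits S B n"
  unfolding visits_def by (subst card_Un_disjoint[symmetric]) (auto intro!: arg_cong[of _ _ card])

lemma visits_Compl: "visits S (- A) n + visits S A n = n"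
  using visits_Un_disjoint[of "- A" A S n] by (simp add: visits_def)

lemma walk_comb_seq_add: "walk (comb_seq m \<omega> \<omega>') (m + n) = walk \<omega> m + walk \<omega>' n"
proof -
  have "walk (comb_seq m \<omega> \<omega>') (m + n) =
      (\<Sum>i<m. comb_seq m \<omega> \<omega>' i) + (\<Sum>i<n. comb_seq m \<omega> \<omega>' (m + i))"
    unfolding walk_def by (induction n) (simp_all add: algebra_simps)
  then show ?thesis
    by (simp add: walk_def comb_seq_def)
qed

lemma walk_comb_seq_le: "n \<le> m \<Longrightarrow> walk (comb_seq m \<omega> \<omega>') n = walk \<omega> n"
  unfolding walk_def by (intro sum.cong) (auto simp: comb_seq_def)

lemma visits_comb_seq:
  "visits (walk (comb_seq m \<omega> \<omega>')) A (m + n) =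
    visits (walk \<omega>) A m + visits (walk \<omega>') {k. walk \<omega> m + k \<in> A} n"
proof -
  have "visits (walk (comb_seq m \<omega> \<omega>')) A m = visits (walk \<omega>) A m"
    by (auto simp: visits_def walk_comb_seq_le intro!: arg_cong[of _ _ card])
  then show ?thesis
    by (simp add: visits_add walk_comb_seq_add visits_shift_space)
qed

lemma (in sequence_space) indep_coords:
  "P.indep_vars (\<lambda>i. M) (\<lambda>i \<omega>. \<omega> i) (UNIV :: nat set)"
proof (subst P.indep_vars_iff_distr_eq_PiM')
  show "(\<lambda>\<omega>. \<omega> i) \<in> S \<rightarrow>\<^sub>M M" for i
    by (rule measurable_component_singleton) simp
  show "distr S (\<Pi>\<^sub>M i\<in>UNIV. M) (\<lambda>\<omega>. \<lambda>i\<in>UNIV. \<omega> i) = (\<Pi>\<^sub>M i\<in>UNIV. distr S M (\<lambda>\<omega>. \<omega> i))"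
    by (simp add: PiM_component restrict_UNIV)
qed simp

section \<open>Random walks on the integers\<close>

locale int_random_walk =
  fixes Q :: "int pmf" and \<sigma> :: real
  assumes mean: "(\<integral>k. real_of_int k \<partial>Q) = 0"
    and sq_int: "integrable Q (\<lambda>k. (real_of_int k)\<^sup>2)"
    and var: "(\<integral>k. (real_of_int k)\<^sup>2 \<partial>Q) = \<sigma>\<^sup>2"
    and \<sigma>_pos: "0 < \<sigma>"
begin

sublocale sequence_space "measure_pmf Q"
  by unfold_locales

lemma measurable_coord [measurable]: "(\<lambda>\<omega>. f (\<omega> i)) \<in> S \<rightarrow>\<^sub>M borel" for f :: "int \<Rightarrow> real"
proof -
  have "(\<lambda>\<omega>. \<omega> i) \<in> S \<rightarrow>\<^sub>M measure_pmf Q"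
    by (rule measurable_component_singleton) simp
  then show ?thesis
    by (rule measurable_compose) simp
qed

lemma measurable_walk [measurable]: "(\<lambda>\<omega>. walk \<omega> n) \<in> S \<rightarrow>\<^sub>M count_space UNIV"
proof -
  have "{\<omega> \<in> space S. walk \<omega> n = k} \<in> sets S" for k
  proof -
    have "{\<omega> \<in> space S. walk \<omega> n = k} = {\<omega> \<in> space S. (\<Sum>i<n. real_of_int (\<omega> i)) = real_of_int k}"
      by (simp add: walk_def flip: of_int_sum)
    also have "\<dots> \<in> sets S"
      by measurable
    finally show ?thesis .
  qed
  then show ?thesis
    by (subst measurable_count_space_eq2_countable) (auto simp: vimage_def Int_def conj_commute)
qed

lemma measurable_visits [measurable]: "(\<lambda>\<omega>. visits (walk \<omega>) A n) \<in> S \<rightarrow>\<^sub>M count_space UNIV"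
proof -
  have "(\<lambda>\<omega>. real (visits (walk \<omega>) A n)) \<in> S \<rightarrow>\<^sub>M borel"
    unfolding visits_eq_sum by measurable
  then have "{\<omega> \<in> space S. real (visits (walk \<omega>) A n) = real k} \<in> sets S" for k
    by measurable
  then show ?thesis
    by (subst measurable_count_space_eq2_countable) (auto simp: vimage_def Int_def conj_commute)
qed

lemma measurable_walk_fun [measurable]: "(\<lambda>\<omega>. f (walk \<omega> n)) \<in> S \<rightarrow>\<^sub>M borel"
  for f :: "int \<Rightarrow> 'b::topological_space"
  by (rule measurable_compose[OF measurable_walk]) simp

lemma measurable_visits_fun [measurable]: "(\<lambda>\<omega>. f (visits (walk \<omega>) A n)) \<in> S \<rightarrow>\<^sub>M borel"
  for f :: "nat \<Rightarrow> 'b::topological_space"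
  by (rule measurable_compose[OF measurable_visits]) simp

lemma coord_distr: "distr S (measure_pmf Q) (\<lambda>\<omega>. \<omega> i) = measure_pmf Q"
  by (rule PiM_component) simp

text \<open>
The Markov property in the form used throughout: two independent i.i.d. sequences, the second appended to
the first \<open>m\<close> terms of the other, form an i.i.d. sequence again.
\<close>

lemma nn_integral_comb_seq:
  assumes [measurable]: "f \<in> borel_measurable S"
  shows "(\<integral>\<^sup>+\<omega>. f \<omega> \<partial>S) = (\<integral>\<^sup>+\<omega>. \<integral>\<^sup>+\<omega>'. f (comb_seq m \<omega> \<omega>') \<partial>S \<partial>S)"
proof -
  have "(\<integral>\<^sup>+\<omega>. f \<omega> \<partial>S) = (\<integral>\<^sup>+\<omega>. f \<omega> \<partial>distr (S \<Otimes>\<^sub>M S) S (\<lambda>(\<omega>, \<omega>'). comb_seq m \<omega> \<omega>'))"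
    by (simp add: PiM_comb_seq)
  also have "\<dots> = (\<integral>\<^sup>+z. f (case z of (\<omega>, \<omega>') \<Rightarrow> comb_seq m \<omega> \<omega>') \<partial>(S \<Otimes>\<^sub>M S))"
    by (intro nn_integral_distr measurable_comb_seq) simp
  also have "\<dots> = (\<integral>\<^sup>+\<omega>. \<integral>\<^sup>+\<omega>'. f (comb_seq m \<omega> \<omega>') \<partial>S \<partial>S)"
    by (subst P.nn_integral_fst[symmetric])
       (auto intro!: measurable_compose[OF measurable_comb_seq])
  finally show ?thesis .
qed

lemma nn_integral_step:
  "(\<integral>\<^sup>+\<omega>. ennreal ((a + real_of_int (\<omega> 0))\<^sup>2) \<partial>S) = ennreal (a\<^sup>2 + \<sigma>\<^sup>2)"
proof -
  have i1: "integrable Q (\<lambda>k. real_of_int k)"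
    using sq_int by (rule measure_pmf.square_integrable_imp_integrable[rotated]) simp
  have "(\<integral>\<^sup>+\<omega>. ennreal ((a + real_of_int (\<omega> 0))\<^sup>2) \<partial>S) =
      (\<integral>\<^sup>+k. ennreal ((a + real_of_int k)\<^sup>2) \<partial>distr S (measure_pmf Q) (\<lambda>\<omega>. \<omega> 0))"
    by (subst nn_integral_distr) (auto intro!: measurable_component_singleton)
  also have "\<dots> = (\<integral>\<^sup>+k. ennreal ((a + real_of_int k)\<^sup>2) \<partial>Q)"
    by (simp add: coord_distr)
  also have "\<dots> = ennreal (\<integral>k. (a + real_of_int k)\<^sup>2 \<partial>Q)"
    using i1 sq_int by (intro nn_integral_eq_integral AE_I2 zero_le_power2) (auto simp: power2_sum)
  also have "(\<integral>k. (a + real_of_int k)\<^sup>2 \<partial>Q) = a\<^sup>2 + \<sigma>\<^sup>2"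
    using i1 sq_int mean var by (simp add: power2_sum)
  finally show ?thesis .
qed

lemma nn_integral_walk_square:
  "(\<integral>\<^sup>+\<omega>. ennreal ((real_of_int (walk \<omega> n))\<^sup>2) \<partial>S) = ennreal (n * \<sigma>\<^sup>2)"
proof (induction n)
  case 0
  then show ?case by simp
next
  case (Suc n)
  have "(\<integral>\<^sup>+\<omega>. ennreal ((real_of_int (walk \<omega> (Suc n)))\<^sup>2) \<partial>S) =
      (\<integral>\<^sup>+\<omega>. \<integral>\<^sup>+\<omega>'. ennreal ((real_of_int (walk \<omega> n) + real_of_int (\<omega>' 0))\<^sup>2) \<partial>S \<partial>S)"
    using walk_comb_seq_add[of n _ _ 1] by (subst nn_integral_comb_seq[of _ n]) (simp_all add: walk_def)
  also have "\<dots> = (\<integral>\<^sup>+\<omega>. ennreal ((real_of_int (walk \<omega> n))\<^sup>2) + ennreal (\<sigma>\<^sup>2) \<partial>S)"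
    by (simp only: nn_integral_step ennreal_plus[symmetric] zero_le_power2)
  also have "\<dots> = ennreal (n * \<sigma>\<^sup>2) + ennreal (\<sigma>\<^sup>2)"
    by (subst nn_integral_add) (simp_all add: Suc.IH P.emeasure_space_1)
  finally show ?case
    by (simp add: ennreal_plus[symmetric] algebra_simps del: ennreal_plus)
qed

lemma walk_Chebyshev:
  assumes "0 < t"
  shows "P.prob {\<omega> \<in> space S. t \<le> \<bar>real_of_int (walk \<omega> n)\<bar>} \<le> n * \<sigma>\<^sup>2 / t\<^sup>2"
proof -
  have sq: "t\<^sup>2 \<le> (real_of_int x)\<^sup>2 \<longleftrightarrow> t \<le> \<bar>real_of_int x\<bar>" for x
    using assms by (metis abs_le_square_iff abs_of_pos)
  have eq: "ennreal (1 / t\<^sup>2) * ennreal y = ennreal (y / t\<^sup>2)" if "0 \<le> y" for y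
    using that assms by (simp add: ennreal_mult[symmetric])
  have "emeasure S ({\<omega> \<in> space S. 1 \<le> ennreal (1 / t\<^sup>2) * ennreal ((real_of_int (walk \<omega> n))\<^sup>2)} \<inter> space S)
      \<le> ennreal (1 / t\<^sup>2) * (\<integral>\<^sup>+\<omega>. ennreal ((real_of_int (walk \<omega> n))\<^sup>2) * indicator (space S) \<omega> \<partial>S)"
    by (rule order_trans[OF _ nn_integral_Markov_inequality]) (auto intro!: emeasure_mono)
  also have "{\<omega> \<in> space S. 1 \<le> ennreal (1 / t\<^sup>2) * ennreal ((real_of_int (walk \<omega> n))\<^sup>2)} =
      {\<omega> \<in> space S. t \<le> \<bar>real_of_int (walk \<omega> n)\<bar>}"
    using assms by (simp add: eq ennreal_ge_1 le_divide_eq sq)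
  also have "(\<integral>\<^sup>+\<omega>. ennreal ((real_of_int (walk \<omega> n))\<^sup>2) * indicator (space S) \<omega> \<partial>S) = ennreal (n * \<sigma>\<^sup>2)"
    by (subst nn_integral_walk_square[symmetric]) (auto intro!: nn_integral_cong)
  finally show ?thesis
    using assms by (simp add: eq P.emeasure_eq_measure Int_def conj_ac)
qed

lemma walk_clt:
  "weak_conv_m (\<lambda>n. distr S borel (\<lambda>\<omega>. real_of_int (walk \<omega> n) / sqrt (n * \<sigma>\<^sup>2)))
    std_normal_distribution"
proof -
  have E: "P.expectation (\<lambda>\<omega>. f (\<omega> n)) = (\<integral>k. f k \<partial>Q)" for n and f :: "int \<Rightarrow> real"
    by (subst (2) coord_distr[of n, symmetric], subst integral_distr)
       (auto intro!: measurable_component_singleton)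
  have int: "integrable S (\<lambda>\<omega>. f (\<omega> n)) \<longleftrightarrow> integrable Q f" for n and f :: "int \<Rightarrow> real"
    by (subst (2) coord_distr[of n, symmetric], subst integrable_distr_eq)
       (auto intro!: measurable_component_singleton)
  have "weak_conv_m (\<lambda>n. distr S borel (\<lambda>\<omega>. (\<Sum>i<n. real_of_int (\<omega> i) - 0) / sqrt (n * \<sigma>\<^sup>2)))
      std_normal_distribution"
  proof (rule P.central_limit_theorem)
    show "P.indep_vars (\<lambda>i. borel) (\<lambda>i \<omega>. real_of_int (\<omega> i)) UNIV"
      using P.indep_vars_compose2[OF indep_coords, of "\<lambda>_. real_of_int" "\<lambda>_. borel"] by simp
    show "distr S borel (\<lambda>\<omega>. real_of_int (\<omega> n)) = distr Q borel real_of_int" for n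
      by (subst (2) coord_distr[of n, symmetric], subst distr_distr)
         (auto simp: comp_def intro!: measurable_component_singleton)
  qed (use E[of "real_of_int"] E[of "\<lambda>k. (real_of_int k)\<^sup>2"] int[of "\<lambda>k. (real_of_int k)\<^sup>2"]
       in \<open>simp_all add: mean var sq_int \<sigma>_pos\<close>)
  then show ?thesis
    by (simp add: walk_def)
qed

lemma std_normal_singleton: "measure std_normal_distribution {x} = 0"
proof -
  have "AE y in lborel. ennreal (std_normal_density y) * indicator {x} y = 0"
    using AE_lborel_singleton[of x] by eventually_elim auto
  then have "emeasure std_normal_distribution {x} = (\<integral>\<^sup>+y. 0 \<partial>lborel)"
    by (subst emeasure_density) (auto intro: nn_integral_cong_AE)
  then show ?thesis
    by (simp add: measure_def)
qed

lemma cdf_walk: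
  "cdf (distr S borel (\<lambda>\<omega>. real_of_int (walk \<omega> n) / sqrt (n * \<sigma>\<^sup>2))) y =
    P.prob {\<omega> \<in> space S. real_of_int (walk \<omega> n) / sqrt (n * \<sigma>\<^sup>2) \<le> y}"
  unfolding cdf_def by (subst measure_distr) (auto simp: vimage_def Int_def conj_commute)

lemma walk_cdf_tendsto:
  "(\<lambda>n. P.prob {\<omega> \<in> space S. real_of_int (walk \<omega> n) / sqrt (n * \<sigma>\<^sup>2) \<le> y})
    \<longlonglongrightarrow> cdf std_normal_distribution y"
proof -
  interpret N: real_distribution std_normal_distribution
    by (rule real_dist_normal_dist)
  have "isCont (cdf std_normal_distribution) y"
    by (simp add: N.isCont_cdf std_normal_singleton)
  with walk_clt show ?thesis
    by (simp add: weak_conv_m_def weak_conv_def cdf_walk)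
qed

text \<open>
Suppose that sites \<open>k\<^sub>n\<close> carry mass at least \<open>e\<close> at infinitely many times. By Chebyshev's inequality
the rescaled sites \<open>k\<^sub>n / sqrt (n \<sigma>\<^sup>2)\<close> are bounded, so they accumulate somewhere, and there the normal
distribution would have an atom of mass at least \<open>e\<close>.
\<close>

lemma walk_anticoncentration:
  assumes "0 < e"
  shows "\<forall>\<^sub>F n in sequentially. \<forall>k. P.prob {\<omega> \<in> space S. walk \<omega> n = k} \<le> e"
proof (rule ccontr)
  interpret N: real_distribution std_normal_distribution
    by (rule real_dist_normal_dist)
  let ?F = "cdf std_normal_distribution"
  define G where "G n y = P.prob {\<omega> \<in> space S. real_of_int (walk \<omega> n) / sqrt (n * \<sigma>\<^sup>2) \<le> y}" for n :: nat and y
  assume "\<not> ?thesis"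
  then have "infinite {n. \<exists>k. e < P.prob {\<omega> \<in> space S. walk \<omega> n = k}}"
    by (simp add: not_eventually not_le frequently_cofinite[symmetric] cofinite_eq_sequentially)
  then have "infinite ({n. \<exists>k. e < P.prob {\<omega> \<in> space S. walk \<omega> n = k}} - {0})"
    by simp
  from infinite_enumerate[OF this] obtain r :: "nat \<Rightarrow> nat" where r: "strict_mono r"
    and "\<forall>i. r i \<in> {n. \<exists>k. e < P.prob {\<omega> \<in> space S. walk \<omega> n = k}} - {0}"
    by blast
  then have r0: "0 < r i" and "\<exists>k. e < P.prob {\<omega> \<in> space S. walk \<omega> (r i) = k}" for i
    by auto
  then obtain k where k: "\<And>i. e < P.prob {\<omega> \<in> space S. walk \<omega> (r i) = k i}"
    by metis
  define y where "y i = real_of_int (k i) / sqrt (r i * \<sigma>\<^sup>2)" for i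
  have y2: "(y i)\<^sup>2 \<le> 1 / e" for i
  proof (cases "k i = 0")
    case False
    have "e < P.prob {\<omega> \<in> space S. walk \<omega> (r i) = k i}"
      by (rule k)
    also have "\<dots> \<le> P.prob {\<omega> \<in> space S. \<bar>real_of_int (k i)\<bar> \<le> \<bar>real_of_int (walk \<omega> (r i))\<bar>}"
      by (intro P.finite_measure_mono) auto
    also have "\<dots> \<le> r i * \<sigma>\<^sup>2 / (real_of_int (k i))\<^sup>2"
      using walk_Chebyshev[of "\<bar>real_of_int (k i)\<bar>" "r i"] False by simp
    also have "\<dots> = 1 / (y i)\<^sup>2"
      using False r0[of i] by (simp add: y_def power_divide)
    finally have "e < 1 / (y i)\<^sup>2" .
    moreover have "0 < (y i)\<^sup>2"
      using False r0[of i] \<sigma>_pos by (simp add: y_def)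
    ultimately have "e * (y i)\<^sup>2 < 1"
      by (simp only: pos_less_divide_eq)
    then show ?thesis
      using assms by (simp add: pos_le_divide_eq mult.commute)
  qed (use assms in \<open>simp add: y_def\<close>)
  have "\<bar>y i\<bar> \<le> sqrt (1 / e)" for i
    using real_sqrt_le_mono[OF y2[of i]] by simp
  then have "\<forall>i. y i \<in> {- sqrt (1 / e) .. sqrt (1 / e)}"
    by (simp add: abs_le_iff minus_le_iff) 
  moreover have "seq_compact {- sqrt (1 / e) .. sqrt (1 / e)}"
    using compact_Icc compact_imp_seq_compact by blast
  ultimately obtain l s where s: "strict_mono (s :: nat \<Rightarrow> nat)" "(y \<circ> s) \<longlonglongrightarrow> l"
    unfolding seq_compact_def by blast
  have cont: "isCont ?F z" for z
    by (simp add: N.isCont_cdf std_normal_singleton)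
  have "((\<lambda>a. ?F (l + a) - ?F (l - a)) \<longlongrightarrow> ?F (l + 0) - ?F (l - 0)) (at_right 0)"
    by (intro tendsto_intros isCont_tendsto_compose[OF cont])
  then have "\<forall>\<^sub>F a in at_right 0. ?F (l + a) - ?F (l - a) < e"
    using assms by (intro order_tendstoD) auto
  moreover have "\<forall>\<^sub>F a in at_right (0::real). 0 < a"
    by (rule eventually_at_right_less)
  ultimately have "\<forall>\<^sub>F a in at_right 0. 0 < a \<and> ?F (l + a) - ?F (l - a) < e"
    by (rule eventually_conj[rotated])
  then obtain a where a: "0 < a" "?F (l + a) - ?F (l - a) < e"
    using eventually_happens'[OF trivial_limit_at_right_real] by blast
  have "(\<lambda>i. G (r (s i)) (l + a) - G (r (s i)) (l - a)) \<longlonglongrightarrow> ?F (l + a) - ?F (l - a)"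
  proof -
    have "strict_mono (r \<circ> s)"
      using r s(1) by (rule strict_mono_o)
    from LIMSEQ_subseq_LIMSEQ[OF walk_cdf_tendsto this]
    have "(\<lambda>i. G (r (s i)) z) \<longlonglongrightarrow> ?F z" for z
      by (simp add: G_def comp_def)
    then show ?thesis
      by (intro tendsto_diff)
  qed
  moreover have "\<forall>\<^sub>F i in sequentially. e \<le> G (r (s i)) (l + a) - G (r (s i)) (l - a)"
  proof -
    have "\<forall>\<^sub>F i in sequentially. l - a < y (s i)" "\<forall>\<^sub>F i in sequentially. y (s i) < l + a"
      using order_tendstoD[OF s(2)] a(1) by (simp_all add: comp_def)
    then show ?thesis
    proof eventually_elim
      case (elim i)
      let ?Z = "\<lambda>\<omega>. real_of_int (walk \<omega> (r (s i))) / sqrt (r (s i) * \<sigma>\<^sup>2)"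
      have "e \<le> P.prob {\<omega> \<in> space S. walk \<omega> (r (s i)) = k (s i)}"
        using k[of "s i"] by simp
      also have "\<dots> \<le> P.prob ({\<omega> \<in> space S. ?Z \<omega> \<le> l + a} - {\<omega> \<in> space S. ?Z \<omega> \<le> l - a})"
        using elim by (intro P.finite_measure_mono) (auto simp: y_def)
      also have "\<dots> = G (r (s i)) (l + a) - G (r (s i)) (l - a)"
        unfolding G_def using a(1) by (intro P.finite_measure_Diff) auto
      finally show ?case .
    qed
  qed
  ultimately have "e \<le> ?F (l + a) - ?F (l - a)"
    by (intro tendsto_lowerbound) auto
  with a(2) show False
    by simp
qed

section \<open>Every site is visited a vanishing fraction of the time\<close>

text \<open>
Uniformity over the site is the same as uniformity over the starting point, by translation. So after
the first block the conditional exponential moment of the visits in the remaining blocks obeys the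
same bound, wherever the walk happens to be, and the bounds multiply.
\<close>

lemma nn_integral_exp_visits_le_power:
  fixes u :: real
  assumes c: "\<And>k. (\<integral>\<^sup>+\<omega>. ennreal (exp (u * visits (walk \<omega>) {k} B)) \<partial>S) \<le> ennreal c"
  shows "(\<integral>\<^sup>+\<omega>. ennreal (exp (u * visits (walk \<omega>) {k} (m * B))) \<partial>S) \<le> ennreal c ^ m"
proof (induction m arbitrary: k)
  case 0
  then show ?case
    by (simp add: P.emeasure_space_1)
next
  case (Suc m)
  have set: "{i. w + i \<in> {k}} = {k - w}" for w :: int
    by auto
  have "(\<integral>\<^sup>+\<omega>. ennreal (exp (u * visits (walk \<omega>) {k} (Suc m * B))) \<partial>S) =
     (\<integral>\<^sup>+\<omega>. \<integral>\<^sup>+\<omega>'. ennreal (exp (u * visits (walk \<omega>) {k} B)) *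
        ennreal (exp (u * visits (walk \<omega>') {k - walk \<omega> B} (m * B))) \<partial>S \<partial>S)"
    unfolding mult_Suc
    by (subst nn_integral_comb_seq[of _ B],
        rule measurable_visits_fun[of "\<lambda>v. ennreal (exp (u * real v))"])
       (simp only: visits_comb_seq set of_nat_add distrib_left exp_add ennreal_mult exp_ge_zero)
  also have "\<dots> = (\<integral>\<^sup>+\<omega>. ennreal (exp (u * visits (walk \<omega>) {k} B)) *
        (\<integral>\<^sup>+\<omega>'. ennreal (exp (u * visits (walk \<omega>') {k - walk \<omega> B} (m * B))) \<partial>S) \<partial>S)"
    by (intro nn_integral_cong nn_integral_cmult) simp
  also have "\<dots> \<le> (\<integral>\<^sup>+\<omega>. ennreal (exp (u * visits (walk \<omega>) {k} B)) * ennreal c ^ m \<partial>S)"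
    by (intro nn_integral_mono mult_left_mono Suc.IH) simp
  also have "\<dots> = (\<integral>\<^sup>+\<omega>. ennreal (exp (u * visits (walk \<omega>) {k} B)) \<partial>S) * ennreal c ^ m"
    by (intro nn_integral_multc) simp
  also have "\<dots> \<le> ennreal c * ennreal c ^ m"
    by (intro mult_right_mono c) simp
  finally show ?case
    by simp
qed

lemma expectation_visits:
  "P.expectation (\<lambda>\<omega>. real (visits (walk \<omega>) A n)) =
    (\<Sum>j<n. P.prob {\<omega> \<in> space S. walk \<omega> j \<in> A})"
proof -
  have int: "integrable S (\<lambda>\<omega>. indicator A (walk \<omega> j) :: real)" for j
    by (rule P.integrable_const_bound[of _ 1]) (auto simp: indicator_def)
  have "P.expectation (\<lambda>\<omega>. indicator A (walk \<omega> j) :: real) = P.prob {\<omega> \<in> space S. walk \<omega> j \<in> A}" for j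
  proof -
    have "P.expectation (\<lambda>\<omega>. indicator A (walk \<omega> j) :: real) =
        P.expectation (indicator {\<omega> \<in> space S. walk \<omega> j \<in> A})"
      by (intro Bochner_Integration.integral_cong) (auto simp: indicator_def)
    then show ?thesis
      by simp
  qed
  then show ?thesis
    unfolding visits_eq_sum by (subst Bochner_Integration.integral_sum) (auto intro: int)
qed

text \<open>
A long block makes the expected fraction of visits to any one site small, and \<open>exp\<close> is at most
\<open>1 + 2 v\<close> for a fraction \<open>v\<close>.
\<close>

lemma block_exp_moment:
  assumes "0 < e"
  obtains B where "0 < B"
    "\<And>k. (\<integral>\<^sup>+\<omega>. ennreal (exp (visits (walk \<omega>) {k} B / B)) \<partial>S) \<le> ennreal (exp e)"
proof -
  obtain n0 where n0: "\<And>n k. n0 \<le> n \<Longrightarrow> P.prob {\<omega> \<in> space S. walk \<omega> n = k} \<le> e / 4"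
    using walk_anticoncentration[of "e / 4"] assms by (auto simp: eventually_sequentially)
  \<comment> \<open>the first \<open>n0\<close> times, about which nothing is known, make up at most a fraction \<open>e/4\<close> of the block\<close>
  define B where "B = max 1 (nat \<lceil>4 * n0 / e\<rceil>)"
  have B: "0 < B" "4 * n0 / e \<le> B"
    by (auto simp: B_def) linarith
  have "(\<integral>\<^sup>+\<omega>. ennreal (exp (visits (walk \<omega>) {k} B / B)) \<partial>S) \<le> ennreal (exp e)" for k
  proof -
    let ?V = "\<lambda>\<omega>. real (visits (walk \<omega>) {k} B)"
    have int: "integrable S ?V"
      by (rule P.integrable_const_bound[of _ B]) (auto simp: visits_le)
    have "P.expectation ?V = (\<Sum>j<B. P.prob {\<omega> \<in> space S. walk \<omega> j = k})"
      using expectation_visits[of "{k}" B] by simp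
    also have "\<dots> \<le> (\<Sum>j<B. (if j < n0 then 1 else 0) + e / 4)"
      using n0 assms by (intro sum_mono) (auto simp: not_less intro: add_increasing2)
    also have "\<dots> \<le> n0 + B * (e / 4)"
    proof -
      have "(\<Sum>j<B. if j < n0 then 1 else 0 :: real) = card ({..<B} \<inter> {j. j < n0})"
        by (simp add: sum.If_cases)
      also have "\<dots> \<le> card {..<n0}"
        by (intro of_nat_mono card_mono) auto
      finally show ?thesis
        by (simp add: sum.distrib)
    qed
    also have "\<dots> \<le> B * (e / 2)"
      using B assms by (simp add: field_simps)
    finally have E: "P.expectation ?V \<le> B * (e / 2)" .
    have "(\<integral>\<^sup>+\<omega>. ennreal (exp (?V \<omega> / B)) \<partial>S) \<le> (\<integral>\<^sup>+\<omega>. ennreal (1 + 2 * (?V \<omega> / B)) \<partial>S)"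
    proof (intro nn_integral_mono ennreal_leI)
      fix \<omega>
      let ?v = "?V \<omega> / B"
      have v: "0 \<le> ?v" "?v \<le> 1"
        using visits_le[of "walk \<omega>" "{k}" B] B(1) by auto
      have "exp ?v \<le> 1 + ?v + ?v\<^sup>2"
        using exp_bound[OF v] .
      also have "?v\<^sup>2 \<le> ?v"
        unfolding power2_eq_square using v by (intro mult_left_le)
      finally show "exp ?v \<le> 1 + 2 * ?v"
        by simp
    qed
    also have "\<dots> = ennreal (P.expectation (\<lambda>\<omega>. 1 + 2 * (?V \<omega> / B)))"
      using int by (intro nn_integral_eq_integral) auto
    also have "P.expectation (\<lambda>\<omega>. 1 + 2 * (?V \<omega> / B)) = 1 + 2 * (P.expectation ?V / B)"
      using int by (simp add: P.prob_space)
    also have "\<dots> \<le> 1 + e"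
      using E B(1) by (simp add: field_simps)
    also have "\<dots> \<le> exp e"
      by (rule exp_ge_add_one_self)
    finally show ?thesis
      by (simp add: ennreal_leI)
  qed
  with B(1) that show ?thesis
    by blast
qed

text \<open>
With blocks of length \<open>B\<close>, visiting \<open>k\<close> for a fraction \<open>e/2\<close> of the first \<open>m\<close> blocks has probability at
most \<open>exp (-e/4)\<^sup>m\<close>, by Markov's inequality for the exponential moment. The remaining factor 2 bridges
the gap between multiples of \<open>B\<close> and arbitrary times.
\<close>

lemma eventually_visits_le:
  fixes e :: real
  assumes "0 < e"
  shows "AE \<omega> in S. \<forall>\<^sub>F n in sequentially. real (visits (walk \<omega>) {k} n) \<le> e * n"
proof -
  obtain B where B: "0 < B"
    "\<And>k. (\<integral>\<^sup>+\<omega>. ennreal (exp (visits (walk \<omega>) {k} B / B)) \<partial>S) \<le> ennreal (exp (e / 4))"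
    using block_exp_moment[of "e / 4"] assms by auto
  define C where "C m = {\<omega> \<in> space S. e / 2 * m \<le> visits (walk \<omega>) {k} (m * B) / B}" for m :: nat
  have C [measurable]: "C m \<in> sets S" for m
    unfolding C_def by measurable
  have prob: "P.prob (C m) \<le> exp (- (e / 4)) ^ m" for m
  proof -
    let ?V = "\<lambda>\<omega>. real (visits (walk \<omega>) {k} (m * B)) / B"
    have "emeasure S (C m) \<le> (\<integral>\<^sup>+\<omega>. ennreal (exp (- (e / 2 * m))) * ennreal (exp (?V \<omega>)) \<partial>S)"
    proof (subst nn_integral_indicator[symmetric])
      show "(\<integral>\<^sup>+\<omega>. indicator (C m) \<omega> \<partial>S) \<le>
          (\<integral>\<^sup>+\<omega>. ennreal (exp (- (e / 2 * m))) * ennreal (exp (?V \<omega>)) \<partial>S)"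
        by (intro nn_integral_mono)
           (auto simp: C_def indicator_def ennreal_mult[symmetric] exp_add[symmetric] ennreal_ge_1)
    qed simp
    also have "\<dots> = ennreal (exp (- (e / 2 * m))) * (\<integral>\<^sup>+\<omega>. ennreal (exp (?V \<omega>)) \<partial>S)"
      by (intro nn_integral_cmult) simp
    also have "\<dots> \<le> ennreal (exp (- (e / 2 * m))) * ennreal (exp (e / 4)) ^ m"
      using nn_integral_exp_visits_le_power[of "1 / B" B "exp (e / 4)" k m] B(2)
      by (intro mult_left_mono) simp_all
    also have "\<dots> = ennreal (exp (- (e / 4)) ^ m)"
      by (simp add: ennreal_power ennreal_mult[symmetric] exp_of_nat_mult[symmetric] exp_add[symmetric]
        algebra_simps)
    finally show ?thesis
      by (simp add: P.emeasure_eq_measure)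
  qed
  have "summable (\<lambda>m. P.prob (C m))"
    using assms by (intro summable_comparison_test'[OF summable_geometric, of "exp (- (e / 4))"])
      (auto intro: prob)
  then have "AE \<omega> in S. \<forall>\<^sub>F m in sequentially. \<omega> \<in> space S - C m"
    by (intro borel_cantelli_AE1) (auto simp: P.emeasure_eq_measure)
  then show ?thesis
  proof eventually_elim
    case (elim \<omega>)
    then obtain m0 where m0: "\<And>m. m0 \<le> m \<Longrightarrow> \<omega> \<notin> C m" and sp: "\<omega> \<in> space S"
      by (auto simp: eventually_sequentially)
    show ?case
    proof (rule eventually_sequentiallyI)
      fix n assume n: "(m0 + 1) * B \<le> n"
      define m where "m = n div B + 1"
      have m: "n \<le> m * B" "(m - 1) * B \<le> n"
        using B(1) by (auto simp: m_def) (metis add.commute dividend_less_times_div less_or_eq_imp_le mult.commute mult_Suc_right)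
      have "m0 + 1 \<le> n div B"
        using n B(1) by (simp add: less_eq_div_iff_mult_less_eq)
      then have "m0 \<le> m" "2 \<le> m"
        by (auto simp: m_def)
      have "real (visits (walk \<omega>) {k} n) \<le> visits (walk \<omega>) {k} (m * B)"
        using m(1) by (intro of_nat_mono visits_mono) auto
      also have "\<dots> \<le> e / 2 * m * B"
        using m0[OF \<open>m0 \<le> m\<close>] sp B(1) by (simp add: C_def field_simps)
      also have "\<dots> \<le> e / 2 * (2 * real (m - 1)) * B"
        using \<open>2 \<le> m\<close> assms by (intro mult_right_mono mult_left_mono) auto
      also have "\<dots> = e * real ((m - 1) * B)"
        by simp
      also have "\<dots> \<le> e * n"
        using m(2) assms by (intro mult_left_mono) (simp_all only: of_nat_le_iff less_imp_le)
      finally show "real (visits (walk \<omega>) {k} n) \<le> e * n" .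
    qed
  qed
qed

end

section \<open>The walk stays positive for long stretches\<close>

text \<open>
Invariance under one shift is invariance under all of them, so membership of \<open>E\<close> is decided by the
coordinates from \<open>n\<close> on, for every \<open>n\<close>: \<open>E\<close> is a tail event.
\<close>

lemma (in sequence_space) shift_invariant_zero_one:
  assumes E: "E \<in> sets S"
    and inv: "\<And>\<omega>. \<omega> \<in> space S \<Longrightarrow> (\<lambda>i. \<omega> (Suc i)) \<in> E \<longleftrightarrow> \<omega> \<in> E"
  shows "P.prob E = 0 \<or> P.prob E = 1"
proof (rule P.kolmogorov_0_1_law)
  let ?A = "\<lambda>i. {(\<lambda>\<omega>. \<omega> i) -` X \<inter> space S | X. X \<in> sets M}"
  have coord: "(\<lambda>\<omega>. \<omega> i) \<in> S \<rightarrow>\<^sub>M M" for i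
    by (rule measurable_component_singleton) simp
  have vim: "?A i = sets (vimage_algebra (space S) (\<lambda>\<omega>. \<omega> i) M)" for i
    using measurable_space[OF coord] by (intro sets_vimage_algebra2[symmetric]) auto
  show "sigma_algebra (space S) (?A i)" for i
    unfolding vim using sets.sigma_algebra_axioms[of "vimage_algebra (space S) (\<lambda>\<omega>. \<omega> i) M"] by simp
  show "P.indep_sets ?A UNIV"
    using indep_coords unfolding P.indep_vars_def2 by simp
  have shift: "(\<lambda>i. \<omega> (i + n)) \<in> E \<longleftrightarrow> \<omega> \<in> E" if "\<omega> \<in> space S" for n \<omega>
    using that
  proof (induction n arbitrary: \<omega>)
    case (Suc n)
    then have "(\<lambda>i. \<omega> (i + n)) \<in> space S"
      by (simp add: space_PiM PiE_iff)
    from inv[OF this] Suc.IH[OF Suc.prems] show ?case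
      by simp
  qed simp
  show "E \<in> P.tail_events ?A"
    unfolding P.tail_events_def
  proof (rule INT_I)
    fix n
    have sub: "(\<Union>(?A ` {n..})) \<subseteq> Pow (space S)"
      by auto
    let ?N = "sigma (space S) (\<Union>(?A ` {n..}))"
    have "(\<lambda>\<omega> i. \<omega> (i + n)) \<in> ?N \<rightarrow>\<^sub>M S"
    proof (rule measurable_PiM_single')
      show "(\<lambda>\<omega>. \<omega> (i + n)) \<in> ?N \<rightarrow>\<^sub>M M" for i
      proof (rule measurableI)
        fix X assume "X \<in> sets M"
        then have "(\<lambda>\<omega>. \<omega> (i + n)) -` X \<inter> space S \<in> \<Union>(?A ` {n..})"
          by (intro UN_I[of "i + n"]) auto
        then show "(\<lambda>\<omega>. \<omega> (i + n)) -` X \<inter> space ?N \<in> sets ?N"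
          using sub by (simp add: sigma_sets.Basic)
      qed (simp add: space_measure_of_conv space_PiM PiE_iff)
      show "(\<lambda>\<omega> i. \<omega> (i + n)) \<in> space ?N \<rightarrow> (\<Pi>\<^sub>E i\<in>UNIV. space M)"
        by (auto simp: space_measure_of_conv space_PiM PiE_iff)
    qed
    from measurable_sets[OF this E]
    have "(\<lambda>\<omega> i. \<omega> (i + n)) -` E \<inter> space S \<in> sigma_sets (space S) (\<Union>(?A ` {n..}))"
      using sub by simp
    moreover have "(\<lambda>\<omega> i. \<omega> (i + n)) -` E \<inter> space S = E"
      using shift sets.sets_into_space[OF E] by auto
    ultimately show "E \<in> sigma_sets (space S) (\<Union>(?A ` {n..}))"
      by simp
  qed
qed

lemma cdf_std_normal_less_1: "cdf std_normal_distribution y < 1"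
proof -
  interpret N: real_distribution std_normal_distribution
    by (rule real_dist_normal_dist)
  have "emeasure std_normal_distribution {y<..} \<noteq> 0"
  proof
    assume "emeasure std_normal_distribution {y<..} = 0"
    then have "AE x in lborel. ennreal (std_normal_density x) * indicator {y<..} x = 0"
      by (simp add: emeasure_density nn_integral_0_iff_AE)
    then have "AE x in lborel. x \<notin> {y<..}"
      by eventually_elim (auto simp: normal_density_def indicator_def split: if_splits)
    then have "emeasure lborel {y<..} = 0"
      by (subst (asm) AE_iff_measurable[of "{y<..}"]) auto
    moreover have "emeasure lborel {y<..y+1} \<le> emeasure lborel {y<..}"
      by (intro emeasure_mono) auto
    ultimately show False
      by simp
  qed
  then have "0 < N.prob {y<..}"
    by (simp add: N.emeasure_eq_measure less_le)
  moreover have "cdf std_normal_distribution y = 1 - N.prob {y<..}"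
    using N.prob_compl[of "{y<..}"] by (simp add: cdf_def Compl_eq_Diff_UNIV[symmetric])
  ultimately show ?thesis
    by simp
qed

context int_random_walk
begin

text \<open>
That the walk is infinitely often at most times positive is a shift-invariant condition only up to
bounded changes of height, time and number of visits. Demanding a surplus of \<open>d\<close> in all three, for
every \<open>d\<close>, absorbs these changes.
\<close>

definition often_high :: "real \<Rightarrow> (nat \<Rightarrow> int) set" where
  "often_high c = {\<omega> \<in> space S. \<forall>d::nat. \<exists>n\<ge>d. c * real n + real d \<le> real (visits (walk \<omega>) {int d<..} n)}"

lemma sets_often_high [measurable]: "often_high c \<in> sets S"
  unfolding often_high_def by measurable

lemma often_high_shift:
  assumes c: "0 \<le> c" "c \<le> 1" and sp: "\<omega> \<in> space S"
  shows "(\<lambda>i. \<omega> (Suc i)) \<in> often_high c \<longleftrightarrow> \<omega> \<in> often_high c"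
proof -
  let ?\<omega>' = "\<lambda>i. \<omega> (Suc i)"
  have "(\<lambda>j. walk \<omega> (1 + j)) = (\<lambda>j. \<omega> 0 + walk ?\<omega>' j)"
    unfolding walk_def by (simp only: plus_1_eq_Suc sum.lessThan_Suc_shift)
  then have v: "visits (walk \<omega>) A (Suc n) = visits (walk \<omega>) A 1 + visits (walk ?\<omega>') {k. \<omega> 0 + k \<in> A} n" for A n
    using visits_add[of "walk \<omega>" A 1 n] by (simp add: visits_shift_space)
  have sp': "?\<omega>' \<in> space S"
    using sp by (simp add: space_PiM PiE_iff)
  define r where "r = nat \<bar>\<omega> 0\<bar> + 1"
  have "\<exists>n\<ge>d. c * n + d \<le> visits (walk \<omega>) {int d<..} n"
    if all: "\<And>d. \<exists>n\<ge>d. c * n + real d \<le> visits (walk ?\<omega>') {int d<..} n" for d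
  proof -
    obtain n where n: "d + r \<le> n" "c * n + real (d + r) \<le> visits (walk ?\<omega>') {int (d + r)<..} n"
      using all[of "d + r"] by blast
    have "visits (walk ?\<omega>') {int (d + r)<..} n \<le> visits (walk ?\<omega>') {k. \<omega> 0 + k \<in> {int d<..}} n"
      by (intro visits_mono) (auto simp: r_def)
    also have "\<dots> \<le> visits (walk \<omega>) {int d<..} (Suc n)"
      unfolding v by simp
    finally have "c * n + real (d + r) \<le> visits (walk \<omega>) {int d<..} (Suc n)"
      using n(2) by linarith
    moreover have "c * Suc n + d \<le> c * n + real (d + r)"
      using c by (simp add: algebra_simps r_def)
    ultimately show ?thesis
      using n(1) by (intro exI[of _ "Suc n"]) auto
  qed
  moreover have "\<exists>n\<ge>d. c * n + d \<le> visits (walk ?\<omega>') {int d<..} n"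
    if all: "\<And>d. \<exists>n\<ge>d. c * n + real d \<le> visits (walk \<omega>) {int d<..} n" for d
  proof -
    obtain n0 where n0: "d + r \<le> n0" "c * n0 + real (d + r) \<le> visits (walk \<omega>) {int (d + r)<..} n0"
      using all[of "d + r"] by blast
    then obtain n where n: "n0 = Suc n"
      by (cases n0) (auto simp: r_def)
    have "visits (walk \<omega>) {int (d + r)<..} (Suc n) \<le> 1 + visits (walk ?\<omega>') {k. \<omega> 0 + k \<in> {int (d + r)<..}} n"
      unfolding v using visits_le[of "walk \<omega>" "{int (d + r)<..}" 1] by (intro add_right_mono)
    also have "\<dots> \<le> 1 + visits (walk ?\<omega>') {int d<..} n"
      by (intro add_left_mono visits_mono) (auto simp: r_def)
    finally have "c * Suc n + real (d + r) \<le> 1 + visits (walk ?\<omega>') {int d<..} n"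
      using n0(2) unfolding n by linarith
    moreover have "1 + (c * n + d) \<le> c * Suc n + real (d + r)"
      using c by (simp add: algebra_simps r_def)
    ultimately show ?thesis
      using n0(1) n by (intro exI[of _ n]) (auto simp: r_def)
  qed
  ultimately have "(\<forall>d::nat. \<exists>n\<ge>d. c * n + d \<le> visits (walk ?\<omega>') {int d<..} n) \<longleftrightarrow>
      (\<forall>d::nat. \<exists>n\<ge>d. c * n + d \<le> visits (walk \<omega>) {int d<..} n)"
    by (intro iffI allI) simp_all
  then show ?thesis
    using sp sp' by (simp add: often_high_def)
qed

text \<open>
Chebyshev's inequality at each single time bounds the expected time spent below \<open>-t\<close>, and Markov's
inequality turns this into a bound for most paths; this replaces a maximal inequality.
\<close>

lemma prob_few_low_visits:
  assumes "0 < m" "0 < t" "4 * real n ^ 2 * \<sigma>\<^sup>2 \<le> m * t\<^sup>2"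
  shows "3 / 4 \<le> P.prob {\<omega> \<in> space S. visits (walk \<omega>) {k. real_of_int k < - t} n \<le> m}"
proof -
  let ?V = "\<lambda>\<omega>. real (visits (walk \<omega>) {k. real_of_int k < - t} n)"
  have int: "integrable S ?V"
    by (rule P.integrable_const_bound[of _ n]) (auto simp: visits_le)
  have "P.expectation ?V = (\<Sum>j<n. P.prob {\<omega> \<in> space S. real_of_int (walk \<omega> j) < - t})"
    by (simp add: expectation_visits)
  also have "\<dots> \<le> (\<Sum>j<n. n * \<sigma>\<^sup>2 / t\<^sup>2)"
  proof (rule sum_mono)
    fix j assume j: "j \<in> {..<n}"
    have "P.prob {\<omega> \<in> space S. real_of_int (walk \<omega> j) < - t} \<le>
        P.prob {\<omega> \<in> space S. t \<le> \<bar>real_of_int (walk \<omega> j)\<bar>}"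
      by (intro P.finite_measure_mono) auto
    also have "\<dots> \<le> j * \<sigma>\<^sup>2 / t\<^sup>2"
      by (rule walk_Chebyshev) fact
    also have "\<dots> \<le> n * \<sigma>\<^sup>2 / t\<^sup>2"
      using j by (intro divide_right_mono mult_right_mono) auto
    finally show "P.prob {\<omega> \<in> space S. real_of_int (walk \<omega> j) < - t} \<le> n * \<sigma>\<^sup>2 / t\<^sup>2" .
  qed
  also have "\<dots> = real n ^ 2 * \<sigma>\<^sup>2 / t\<^sup>2"
    by (simp add: power2_eq_square)
  also have "\<dots> \<le> m / 4"
    using assms by (simp add: divide_le_eq)
  finally have E: "P.expectation ?V \<le> m / 4" .
  have "P.prob {\<omega> \<in> space S. real m \<le> ?V \<omega>} \<le> P.expectation ?V / m"
    using assms(1) int by (intro integral_Markov_inequality_measure[where A = "{}"]) auto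
  also have "\<dots> \<le> 1 / 4"
    using E assms(1) by (simp add: field_simps)
  finally have "P.prob {\<omega> \<in> space S. real m \<le> ?V \<omega>} \<le> 1 / 4" .
  moreover have "1 - P.prob {\<omega> \<in> space S. real m \<le> ?V \<omega>} =
      P.prob (space S - {\<omega> \<in> space S. real m \<le> ?V \<omega>})"
    by (subst P.prob_compl) auto
  moreover have "\<dots> \<le> P.prob {\<omega> \<in> space S. visits (walk \<omega>) {k. real_of_int k < - t} n \<le> m}"
    by (intro P.finite_measure_mono) auto
  ultimately show ?thesis
    by linarith
qed

text \<open>
Split \<open>L * m\<close> steps into the first \<open>m\<close> and the rest. The central limit theorem puts the walk above
\<open>2 t\<close> at time \<open>m\<close> with positive probability, where \<open>t = C sqrt m\<close>; independently of that, the later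
increments are below \<open>-t\<close> for at most \<open>m\<close> further times. What is lost is the initial piece and these
times: two parts out of \<open>L\<close>.
\<close>

lemma prob_mostly_high:
  fixes L :: nat
  assumes L: "2 \<le> L"
  obtains \<delta> C where "0 < \<delta>" "0 < C"
    "\<forall>\<^sub>F m in sequentially. \<delta> \<le> P.prob {\<omega> \<in> space S.
        (L - 2) * m \<le> visits (walk \<omega>) {k. C * sqrt m < real_of_int k} (L * m)}"
proof -
  \<comment> \<open>the choice that makes the failure probability in \<open>prob_few_low_visits\<close> at most \<open>1/4\<close> for \<open>L m\<close> steps\<close>
  define C where "C = 2 * L * \<sigma>"
  have C: "0 < C"
    using L \<sigma>_pos by (simp add: C_def)
  define p where "p = 1 - cdf std_normal_distribution (2 * C / \<sigma>)"
  have p: "0 < p"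
    using cdf_std_normal_less_1 by (simp add: p_def)
  have "(\<lambda>n. 1 - P.prob {\<omega> \<in> space S. real_of_int (walk \<omega> n) / sqrt (n * \<sigma>\<^sup>2) \<le> 2 * C / \<sigma>}) \<longlonglongrightarrow> p"
    unfolding p_def by (intro tendsto_intros walk_cdf_tendsto)
  then have "\<forall>\<^sub>F n in sequentially. p / 2 < 1 - P.prob {\<omega> \<in> space S. real_of_int (walk \<omega> n) / sqrt (n * \<sigma>\<^sup>2) \<le> 2 * C / \<sigma>}"
    using p by (intro order_tendstoD) auto
  moreover have "\<forall>\<^sub>F n::nat in sequentially. 0 < n"
    by (rule eventually_gt_at_top)
  ultimately have "\<forall>\<^sub>F m in sequentially. p / 2 * (3 / 4) \<le> P.prob {\<omega> \<in> space S.
        (L - 2) * m \<le> visits (walk \<omega>) {k. C * sqrt m < real_of_int k} (L * m)}"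
  proof eventually_elim
    case (elim m)
    define t where "t = C * sqrt m"
    have t: "0 < t" "t\<^sup>2 = C\<^sup>2 * m"
      using C elim(2) by (simp_all add: t_def power_mult_distrib)
    define n where "n = (L - 1) * m"
    obtain L0 where L0: "L = L0 + 2"
      using L by (metis add.commute le_Suc_ex)
    have n: "L * m = m + n" "real n \<le> L * m"
      by (simp_all add: n_def L0 algebra_simps)
    let ?U = "{\<omega> \<in> space S. 2 * t < real_of_int (walk \<omega> m)}"
    let ?G = "{\<omega> \<in> space S. visits (walk \<omega>) {k. real_of_int k < - t} n \<le> m}"
    let ?F = "{\<omega> \<in> space S. (L - 2) * m \<le> visits (walk \<omega>) {k. t < real_of_int k} (L * m)}"
    have "real n ^ 2 \<le> (real L * real m) ^ 2"
      using n(2) by (intro power_mono) auto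
    then have "4 * real n ^ 2 * \<sigma>\<^sup>2 \<le> 4 * (real L * real m) ^ 2 * \<sigma>\<^sup>2"
      by (intro mult_right_mono mult_left_mono) auto
    also have "\<dots> = m * t\<^sup>2"
      unfolding t(2) by (simp add: C_def power2_eq_square)
    finally have G: "3 / 4 \<le> P.prob ?G"
      by (intro prob_few_low_visits elim t)
    have "p / 2 \<le> 1 - P.prob {\<omega> \<in> space S. real_of_int (walk \<omega> m) / sqrt (m * \<sigma>\<^sup>2) \<le> 2 * C / \<sigma>}"
      using elim(1) by simp
    also have "\<dots> = P.prob (space S - {\<omega> \<in> space S. real_of_int (walk \<omega> m) / sqrt (m * \<sigma>\<^sup>2) \<le> 2 * C / \<sigma>})"
      by (subst P.prob_compl) auto
    also have "\<dots> \<le> P.prob ?U"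
      using elim(2) \<sigma>_pos by (intro P.finite_measure_mono)
        (auto simp: t_def real_sqrt_mult field_simps not_le)
    finally have U: "p / 2 \<le> P.prob ?U" .
    \<comment> \<open>starting above \<open>2 t\<close>, every increment that is at least \<open>-t\<close> leads above \<open>t\<close>\<close>
    have comb: "comb_seq m \<omega> \<omega>' \<in> ?F" if "\<omega> \<in> ?U" "\<omega>' \<in> ?G" for \<omega> \<omega>'
    proof -
      have "visits (walk \<omega>') (- {k. real_of_int k < - t}) n + visits (walk \<omega>') {k. real_of_int k < - t} n = n"
        by (rule visits_Compl)
      moreover have "visits (walk \<omega>') (- {k. real_of_int k < - t}) n \<le>
          visits (walk \<omega>') {k. walk \<omega> m + k \<in> {k. t < real_of_int k}} n"
        using that(1) by (intro visits_mono) auto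
      moreover have "n = (L - 2) * m + m"
        by (simp add: n_def L0)
      ultimately have "(L - 2) * m \<le> visits (walk \<omega>') {k. walk \<omega> m + k \<in> {k. t < real_of_int k}} n"
        using that(2) by simp
      moreover have "comb_seq m \<omega> \<omega>' \<in> space S"
        by (simp add: space_PiM)
      ultimately show ?thesis
        by (simp add: n visits_comb_seq)
    qed
    have UG: "p / 2 * (3 / 4) \<le> P.prob ?U * P.prob ?G"
      using p by (intro mult_mono U G) auto
    have "ennreal (p / 2 * (3 / 4)) \<le> emeasure S ?U * emeasure S ?G"
      using ennreal_leI[OF UG] by (simp only: P.emeasure_eq_measure ennreal_mult measure_nonneg)
    also have "\<dots> = (\<integral>\<^sup>+\<omega>. indicator ?U \<omega> * emeasure S ?G \<partial>S)"
      by (subst nn_integral_multc) auto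
    also have "\<dots> = (\<integral>\<^sup>+\<omega>. \<integral>\<^sup>+\<omega>'. indicator ?U \<omega> * indicator ?G \<omega>' \<partial>S \<partial>S)"
      by (intro nn_integral_cong, subst nn_integral_cmult) auto
    also have "\<dots> \<le> (\<integral>\<^sup>+\<omega>. \<integral>\<^sup>+\<omega>'. indicator ?F (comb_seq m \<omega> \<omega>') \<partial>S \<partial>S)"
      by (intro nn_integral_mono) (use comb in \<open>auto simp: indicator_def simp del: mem_Collect_eq\<close>)
    also have "\<dots> = (\<integral>\<^sup>+\<omega>. indicator ?F \<omega> \<partial>S)"
      by (rule nn_integral_comb_seq[symmetric]) simp
    also have "\<dots> = ennreal (P.prob ?F)"
      by (simp add: P.emeasure_eq_measure)
    finally show ?case
      by (simp add: t_def)
  qed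
  with p C show ?thesis
    by (intro that[of "p / 2 * (3 / 4)" C]) auto
qed

text \<open>
The events of the preceding lemma have probability at least \<open>\<delta>\<close>, so infinitely many of them occur with
probability at least \<open>\<delta>\<close>. Giving up a third part out of \<open>L\<close> provides the surplus of visits that
\<open>often_high\<close> asks for.
\<close>

lemma AE_often_high:
  fixes L :: nat
  assumes L: "3 \<le> L"
  shows "AE \<omega> in S. \<omega> \<in> often_high (1 - 3 / L)"
proof -
  obtain \<delta> C where \<delta>: "0 < \<delta>" and C: "0 < C" and ev: "\<forall>\<^sub>F m in sequentially. \<delta> \<le> P.prob {\<omega> \<in> space S.
        (L - 2) * m \<le> visits (walk \<omega>) {k. C * sqrt m < real_of_int k} (L * m)}"
    using prob_mostly_high[of L] L by auto
  define F where "F m = {\<omega> \<in> space S.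
        (L - 2) * m \<le> visits (walk \<omega>) {k. C * sqrt m < real_of_int k} (L * m)}" for m :: nat
  have [measurable]: "F m \<in> sets S" for m
    unfolding F_def by measurable
  have sub: "(\<Inter>N. \<Union>m\<in>{N..}. F m) \<subseteq> often_high (1 - 3 / L)"
  proof
    fix \<omega> assume \<omega>: "\<omega> \<in> (\<Inter>N. \<Union>m\<in>{N..}. F m)"
    then have "\<omega> \<in> space S"
      by (auto simp: F_def)
    moreover have "\<exists>n\<ge>d. (1 - 3 / L) * n + d \<le> visits (walk \<omega>) {int d<..} n" for d :: nat
    proof -
      obtain m where m: "max d (nat \<lceil>(d / C)\<^sup>2\<rceil>) \<le> m" "\<omega> \<in> F m"
        using \<omega> by (metis (no_types, lifting) INT_E UN_E UNIV_I atLeast_iff)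
      have "(d / C)\<^sup>2 \<le> m"
        using m(1) by linarith
      then have "d / C \<le> sqrt m"
        by (rule real_le_rsqrt)
      then have d: "d \<le> C * sqrt m"
        using C by (simp add: field_simps)
      have "(1 - 3 / L) * (L * m) + d \<le> (real L - 3) * m + m"
        using m(1) L by (simp add: field_simps)
      also have "\<dots> = real ((L - 2) * m)"
        using L by (simp add: of_nat_diff algebra_simps)
      also have "\<dots> \<le> visits (walk \<omega>) {k. C * sqrt m < real_of_int k} (L * m)"
        using m(2) unfolding F_def by (auto simp del: of_nat_mult)
      also have "\<dots> \<le> visits (walk \<omega>) {int d<..} (L * m)"
        using d by (intro of_nat_mono visits_mono) auto
      finally show ?thesis
        using m(1) L by (intro exI[of _ "L * m"]) (auto intro: order_trans[of d m])
    qed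
    ultimately show "\<omega> \<in> often_high (1 - 3 / L)"
      by (simp add: often_high_def)
  qed
  have "\<delta> \<le> P.prob (\<Inter>N. \<Union>m\<in>{N..}. F m)"
  proof (rule tendsto_lowerbound)
    show "(\<lambda>N. P.prob (\<Union>m\<in>{N..}. F m)) \<longlonglongrightarrow> P.prob (\<Inter>N. \<Union>m\<in>{N..}. F m)"
      by (intro P.finite_Lim_measure_decseq) (auto simp: decseq_def Bex_def intro: order_trans)
    have "\<forall>\<^sub>F N in sequentially. \<delta> \<le> P.prob (F N)"
      using ev by (simp add: F_def)
    then show "\<forall>\<^sub>F N in sequentially. \<delta> \<le> P.prob (\<Union>m\<in>{N..}. F m)"
    proof eventually_elim
      case (elim N)
      have "P.prob (F N) \<le> P.prob (\<Union>m\<in>{N..}. F m)"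
        by (intro P.finite_measure_mono) auto
      with elim show ?case
        by simp
    qed
  qed simp
  also have "\<dots> \<le> P.prob (often_high (1 - 3 / L))"
    by (intro P.finite_measure_mono sub) simp
  finally have "P.prob (often_high (1 - 3 / L)) \<noteq> 0"
    using \<delta> by simp
  moreover have "P.prob (often_high (1 - 3 / L)) = 0 \<or> P.prob (often_high (1 - 3 / L)) = 1"
    using L by (intro shift_invariant_zero_one often_high_shift) (auto simp: field_simps)
  ultimately have "P.prob (often_high (1 - 3 / L)) = 1"
    by simp
  then show ?thesis
    by (simp add: P.prob_eq_1)
qed

lemma frequently_visits_positive:
  "AE \<omega> in S. \<forall>e::real. 0 < e \<longrightarrow> (\<exists>\<^sub>F n in sequentially. (1 - e) * n \<le> visits (walk \<omega>) {0<..} n)"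
proof -
  have "AE \<omega> in S. \<forall>L\<ge>3. \<omega> \<in> often_high (1 - 3 / real L)"
    using AE_often_high by (simp add: AE_all_countable)
  then show ?thesis
  proof eventually_elim
    case (elim \<omega>)
    show ?case
    proof (intro allI impI)
      fix e :: real assume e: "0 < e"
      define L where "L = max 3 (nat \<lceil>3 / e\<rceil>)"
      have L: "3 \<le> L" "3 / e \<le> L"
        unfolding L_def by (auto simp: max_def) linarith+
      then have "3 / L \<le> e"
        using e by (simp add: field_simps)
      show "\<exists>\<^sub>F n in sequentially. (1 - e) * n \<le> visits (walk \<omega>) {0<..} n"
        unfolding frequently_sequentially
      proof
        fix d
        obtain n where n: "d \<le> n" "(1 - 3 / L) * n + d \<le> visits (walk \<omega>) {int d<..} n"
          using elim L(1) unfolding often_high_def by blast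
        have "(1 - e) * n \<le> (1 - 3 / L) * n"
          using \<open>3 / L \<le> e\<close> by (intro mult_right_mono) auto
        also have "\<dots> \<le> visits (walk \<omega>) {int d<..} n"
          using n(2) by linarith
        also have "\<dots> \<le> visits (walk \<omega>) {0<..} n"
          by (intro of_nat_mono visits_mono) auto
        finally show "\<exists>n\<ge>d. (1 - e) * n \<le> visits (walk \<omega>) {0<..} n"
          using n(1) by blast
      qed
    qed
  qed
qed

end

section \<open>Time averages along an oscillating path\<close>

text \<open>
The almost sure properties of a centred walk from which the limit measures are computed.
\<close>

definition oscillating :: "(nat \<Rightarrow> int) \<Rightarrow> bool" where
  "oscillating S \<longleftrightarrow>
    (\<forall>k. (\<lambda>n. real (visits S {k} n) / n) \<longlonglongrightarrow> 0) \<and>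
    (\<forall>e::real. 0 < e \<longrightarrow> (\<exists>\<^sub>F n in sequentially. (1 - e) * n \<le> visits S {0<..} n)) \<and>
    (\<forall>e::real. 0 < e \<longrightarrow> (\<exists>\<^sub>F n in sequentially. (1 - e) * n \<le> visits S {..<0} n))"

definition pos_fraction :: "(nat \<Rightarrow> int) \<Rightarrow> nat \<Rightarrow> real" where
  "pos_fraction S n = visits S {0<..} n / n"

definition time_average :: "(nat \<Rightarrow> real) \<Rightarrow> nat \<Rightarrow> real" where
  "time_average f n = (1 / real n) * (\<Sum>j<n. f j)"

lemma pos_fraction_bounds: "0 \<le> pos_fraction S n" "pos_fraction S n \<le> 1"
  using visits_le[of S "{0<..}" n] by (auto simp: pos_fraction_def divide_le_eq_1)

text \<open>
A sequence tending to 0 at both ends of \<open>\<int>\<close> is small off a finite set of sites, and these take up a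
vanishing fraction of the time.
\<close>

lemma time_average_null_sites:
  fixes b :: "int \<Rightarrow> real"
  assumes null: "\<And>k. (\<lambda>n. real (visits S {k} n) / n) \<longlonglongrightarrow> 0"
    and up: "(\<lambda>n. b (int n)) \<longlonglongrightarrow> 0" and down: "(\<lambda>n. b (- int n)) \<longlonglongrightarrow> 0"
  shows "time_average (\<lambda>j. b (S j)) \<longlonglongrightarrow> 0"
proof (rule LIMSEQ_I)
  fix e :: real assume e: "0 < e"
  obtain N1 where N1: "\<And>n. N1 \<le> n \<Longrightarrow> \<bar>b (int n)\<bar> < e / 2"
    using LIMSEQ_D[OF up, of "e / 2"] e by auto
  obtain N2 where N2: "\<And>n. N2 \<le> n \<Longrightarrow> \<bar>b (- int n)\<bar> < e / 2"
    using LIMSEQ_D[OF down, of "e / 2"] e by auto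
  define K where "K = {- int N2..int N1}"
  have b: "\<bar>b i\<bar> \<le> e / 2 + (\<Sum>k\<in>K. \<bar>b k\<bar> * indicator {k} i)" for i
  proof (cases "i \<in> K")
    case True
    have "\<bar>b i\<bar> * indicator {i} i \<le> (\<Sum>k\<in>K. \<bar>b k\<bar> * indicator {k} i)"
      using True by (intro member_le_sum) (auto simp: K_def)
    with e show ?thesis
      by simp
  next
    case False
    then have "\<bar>b i\<bar> < e / 2"
      using N1[of "nat i"] N2[of "nat (- i)"] by (auto simp: K_def not_le)
    moreover have "0 \<le> (\<Sum>k\<in>K. \<bar>b k\<bar> * indicator {k} i)"
      by (intro sum_nonneg) auto
    ultimately show ?thesis
      by simp
  qed
  have bound: "\<bar>time_average (\<lambda>j. b (S j)) n\<bar> \<le> e / 2 + (\<Sum>k\<in>K. \<bar>b k\<bar> * (real (visits S {k} n) / n))" for n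
  proof -
    have "\<bar>\<Sum>j<n. b (S j)\<bar> \<le> (\<Sum>j<n. \<bar>b (S j)\<bar>)"
      by (rule sum_abs)
    also have "\<dots> \<le> (\<Sum>j<n. e / 2 + (\<Sum>k\<in>K. \<bar>b k\<bar> * indicator {k} (S j)))"
      by (intro sum_mono b)
    also have "\<dots> = n * (e / 2) + (\<Sum>k\<in>K. \<bar>b k\<bar> * visits S {k} n)"
      unfolding sum.distrib visits_eq_sum sum_distrib_left
      by (subst sum.swap) simp
    finally have "(1 / n) * \<bar>\<Sum>j<n. b (S j)\<bar> \<le> (1 / n) * (n * (e / 2) + (\<Sum>k\<in>K. \<bar>b k\<bar> * visits S {k} n))"
      by (intro mult_left_mono) auto
    also have "\<dots> \<le> e / 2 + (\<Sum>k\<in>K. \<bar>b k\<bar> * (real (visits S {k} n) / n))"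
      using e by (cases "n = 0") (simp_all add: distrib_left sum_distrib_left sum_divide_distrib)
    finally show ?thesis
      by (simp add: time_average_def abs_mult)
  qed
  have "(\<lambda>n. e / 2 + (\<Sum>k\<in>K. \<bar>b k\<bar> * (real (visits S {k} n) / n))) \<longlonglongrightarrow> e / 2 + (\<Sum>k\<in>K. \<bar>b k\<bar> * 0)"
    by (intro tendsto_intros null)
  then have "\<forall>\<^sub>F n in sequentially. e / 2 + (\<Sum>k\<in>K. \<bar>b k\<bar> * (real (visits S {k} n) / n)) < e"
    using e order_tendstoD(2)[of _ "e / 2" sequentially e] by simp
  then have "\<forall>\<^sub>F n in sequentially. \<bar>time_average (\<lambda>j. b (S j)) n\<bar> < e"
    by eventually_elim (rule order_le_less_trans[OF bound])
  then show "\<exists>N. \<forall>n\<ge>N. norm (time_average (\<lambda>j. b (S j)) n - 0) < e"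
    by (simp add: eventually_sequentially)
qed

text \<open>
Subtracting the step function with values \<open>\<alpha>\<close> on the positive integers and \<open>\<beta>\<close> elsewhere reduces the
claim to a sequence with limit 0 at both ends. The site 0 counts as negative, which is harmless since
it is a null site as well.
\<close>

lemma time_average_two_limits:
  fixes a :: "int \<Rightarrow> real"
  assumes osc: "oscillating S"
    and up: "(\<lambda>n. a (int n)) \<longlonglongrightarrow> \<alpha>" and down: "(\<lambda>n. a (- int n)) \<longlonglongrightarrow> \<beta>"
  shows "(\<lambda>n. time_average (\<lambda>j. a (S j)) n - (\<beta> + pos_fraction S n * (\<alpha> - \<beta>))) \<longlonglongrightarrow> 0"
proof -
  define b where "b k = a k - (\<beta> + indicator {0<..} k * (\<alpha> - \<beta>))" for k :: int
  have "(\<lambda>n. b (int n)) \<longlonglongrightarrow> 0"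
  proof (rule Lim_transform_eventually)
    show "(\<lambda>n. a (int n) - \<alpha>) \<longlonglongrightarrow> 0"
      using up by (simp add: LIM_zero_iff)
    show "\<forall>\<^sub>F n in sequentially. a (int n) - \<alpha> = b (int n)"
      using eventually_gt_at_top[of 0] by eventually_elim (simp add: b_def)
  qed
  moreover have "(\<lambda>n. b (- int n)) \<longlonglongrightarrow> 0"
    using down by (simp add: b_def LIM_zero_iff)
  ultimately have "time_average (\<lambda>j. b (S j)) \<longlonglongrightarrow> 0"
    using osc by (intro time_average_null_sites) (auto simp: oscillating_def)
  moreover have "\<forall>\<^sub>F n in sequentially. time_average (\<lambda>j. b (S j)) n =
      time_average (\<lambda>j. a (S j)) n - (\<beta> + pos_fraction S n * (\<alpha> - \<beta>))"
    using eventually_gt_at_top[of 0]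
  proof eventually_elim
    case (elim n)
    have "(\<Sum>j<n. b (S j)) = (\<Sum>j<n. a (S j)) - (n * \<beta> + visits S {0<..} n * (\<alpha> - \<beta>))"
      by (simp add: b_def sum_subtractf sum.distrib visits_eq_sum sum_distrib_right)
    then show ?case
      using elim by (simp add: time_average_def pos_fraction_def field_simps)
  qed
  ultimately show ?thesis
    by (rule Lim_transform_eventually)
qed

text \<open>
A discrete intermediate value argument: the positive fraction is near 0 at some late time and near 1 at
a later one, and in between it changes by at most \<open>1/n\<close> in each step.
\<close>

lemma frequently_pos_fraction_near:
  assumes osc: "oscillating S" and l: "0 \<le> l" "l \<le> 1" and e: "0 < e"
  shows "\<exists>\<^sub>F n in sequentially. \<bar>pos_fraction S n - l\<bar> \<le> e"
  unfolding frequently_sequentially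
proof
  fix N0 :: nat
  let ?A = "pos_fraction S"
  define N where "N = max (max 1 N0) (nat \<lceil>1 / e\<rceil>)"
  have N: "1 \<le> N" "N0 \<le> N" "1 / e \<le> N"
    unfolding N_def by linarith+
  obtain n1 where n1: "N \<le> n1" "(1 - e) * n1 \<le> visits S {..<0} n1"
    using osc e unfolding oscillating_def frequently_sequentially by blast
  have "visits S {0<..} n1 + visits S {..<0} n1 = visits S ({0<..} \<union> {..<0}) n1"
    by (rule visits_Un_disjoint[symmetric]) auto
  also have "\<dots> \<le> n1"
    by (rule visits_le)
  finally have "real (visits S {0<..} n1) + real (visits S {..<0} n1) \<le> n1"
    by linarith
  then have "real (visits S {0<..} n1) \<le> e * n1"
    using n1(2) by (simp add: algebra_simps)
  also have "\<dots> \<le> (l + e) * n1"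
    using l by (intro mult_right_mono) auto
  finally have A1: "?A n1 \<le> l + e"
    using n1(1) N(1) by (simp add: pos_fraction_def divide_le_eq)
  obtain n2 where n2: "n1 \<le> n2" "(1 - e) * n2 \<le> visits S {0<..} n2"
    using osc e unfolding oscillating_def frequently_sequentially by blast
  then have "1 - e \<le> ?A n2"
    using n1(1) N(1) by (simp add: pos_fraction_def le_divide_eq)
  then have ex: "n1 \<le> n2 \<and> l - e \<le> ?A n2"
    using n2(1) l by simp
  \<comment> \<open>the first time from \<open>n1\<close> on at which the fraction is at least \<open>l - e\<close>; the last step adds at most \<open>1/n\<close>\<close>
  define n where "n = (LEAST n. n1 \<le> n \<and> l - e \<le> ?A n)"
  have n: "n1 \<le> n" "l - e \<le> ?A n"
    using LeastI[of "\<lambda>n. n1 \<le> n \<and> l - e \<le> ?A n", OF ex] by (auto simp: n_def)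
  have "?A n \<le> l + e"
  proof (cases "n = n1")
    case False
    then obtain m where m: "n = Suc m" "n1 \<le> m"
      using n(1) by (cases n) auto
    then have "\<not> (n1 \<le> m \<and> l - e \<le> ?A m)"
      unfolding n_def using not_less_Least[of m] by (metis lessI n_def)
    then have Am: "?A m < l - e"
      using m(2) by simp
    have m0: "0 < m" "1 / e \<le> m"
      using m n1 N by auto
    have "visits S {0<..} n \<le> visits S {0<..} m + 1"
      using visits_add[of S "{0<..}" m 1] visits_le[of "\<lambda>j. S (m + j)" "{0<..}" 1] m(1) by simp
    then have "?A n \<le> (real (visits S {0<..} m) + 1) / n"
      unfolding pos_fraction_def by (intro divide_right_mono) auto
    also have "\<dots> \<le> (real (visits S {0<..} m) + 1) / m"
      using m m0 by (intro divide_left_mono) auto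
    also have "\<dots> = ?A m + 1 / m"
      by (simp add: pos_fraction_def add_divide_distrib)
    also have "1 / m \<le> e"
      using m0 e by (simp add: field_simps)
    finally show ?thesis
      using Am e by linarith
  qed (use A1 in simp)
  then show "\<exists>n\<ge>N0. \<bar>?A n - l\<bar> \<le> e"
    using n n1(1) N(2) by (intro exI[of _ n]) auto
qed

lemma time_average_not_convergent:
  fixes a :: "int \<Rightarrow> real"
  assumes osc: "oscillating S"
    and up: "(\<lambda>n. a (int n)) \<longlonglongrightarrow> \<alpha>" and down: "(\<lambda>n. a (- int n)) \<longlonglongrightarrow> \<beta>"
    and ne: "\<alpha> \<noteq> \<beta>"
  shows "\<not> convergent (time_average (\<lambda>j. a (S j)))"
proof
  assume "convergent (time_average (\<lambda>j. a (S j)))"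
  then obtain L where "time_average (\<lambda>j. a (S j)) \<longlonglongrightarrow> L"
    by (auto simp: convergent_def)
  from tendsto_diff[OF this time_average_two_limits[OF osc up down]]
  have "(\<lambda>n. \<beta> + pos_fraction S n * (\<alpha> - \<beta>)) \<longlonglongrightarrow> L"
    by simp
  then have "(\<lambda>n. (\<beta> + pos_fraction S n * (\<alpha> - \<beta>) - \<beta>) / (\<alpha> - \<beta>)) \<longlonglongrightarrow> (L - \<beta>) / (\<alpha> - \<beta>)"
    using ne by (intro tendsto_intros) auto
  then obtain c where "pos_fraction S \<longlonglongrightarrow> c"
    using ne by auto
  then have ev: "\<forall>\<^sub>F n in sequentially. \<bar>pos_fraction S n - c\<bar> < 1 / 4"
    using tendstoD[of "pos_fraction S" c sequentially "1 / 4"] by (simp add: dist_real_def)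
  have near: "\<bar>c - l\<bar> < 1 / 2" if "0 \<le> l" "l \<le> 1" for l
  proof -
    have "\<exists>\<^sub>F n in sequentially. \<bar>pos_fraction S n - l\<bar> \<le> 1 / 4 \<and> \<bar>pos_fraction S n - c\<bar> < 1 / 4"
      using frequently_pos_fraction_near[OF osc that, of "1 / 4"] ev
      by (intro frequently_eventually_frequently) auto
    then obtain n where "\<bar>pos_fraction S n - l\<bar> \<le> 1 / 4 \<and> \<bar>pos_fraction S n - c\<bar> < 1 / 4"
      by (auto dest: frequently_ex)
    then show ?thesis
      by linarith
  qed
  from near[of 0] near[of 1] show False
    by auto
qed

section \<open>Limit points of empirical measures\<close>

lemma space_borel_on: "space (borel_on M) = pts M"
  by (simp add: space_restrict_space)

lemma singleton_in_borel_on: "p \<in> pts M \<Longrightarrow> {p} \<in> sets (borel_on M)"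
  by (auto simp: sets_restrict_space image_iff intro!: bexI[of _ "{p}"])

lemma continuous_borel_on:
  "continuous_on (pts M) \<phi> \<Longrightarrow> \<phi> \<in> borel_measurable (borel_on M)" for \<phi> :: "complex \<Rightarrow> real"
  by (rule borel_measurable_continuous_on_restrict)

lemma compact_pts: "compact (pts M)"
  unfolding pts_def
  by (cases M) (auto simp: pts_Circle[unfolded pts_def, simplified] intro!: compact_continuous_image continuous_intros)

lemma empirical_measure_eq_distr:
  assumes n: "0 < n" and y: "\<And>j. y j \<in> pts M"
  shows "empirical_measure M y n = distr (measure_pmf (pmf_of_set {..<n})) (borel_on M) y"
proof (rule measure_eqI)
  have sub: "sets (borel_on M) \<subseteq> Pow (pts M)"
    using sets.space_closed[of "borel_on M"] by (simp add: space_restrict_space)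
  have "sigma_algebra (pts M) (sets (borel_on M))"
    using sets.sigma_algebra_axioms[of "borel_on M"] by (simp add: space_restrict_space)
  with sub have eq: "sets (empirical_measure M y n) = sets (borel_on M)"
    unfolding empirical_measure_def
    by (simp add: sets_measure_of sigma_algebra.sigma_sets_eq)
  then show "sets (empirical_measure M y n) = sets (distr (measure_pmf (pmf_of_set {..<n})) (borel_on M) y)"
    by simp
  fix A assume "A \<in> sets (empirical_measure M y n)"
  then have A: "A \<in> sets (borel_on M)"
    by (simp add: eq)
  have "emeasure (empirical_measure M y n) A = ennreal (1 / n) * (\<Sum>j<n. indicator A (y j))"
    by (simp add: emeasure_empirical_measure A dirac_def)
  also have "(\<Sum>j<n. indicator A (y j)) = ennreal (card ({..<n} \<inter> y -` A))"
    by (simp add: indicator_def sum.If_cases ennreal_of_nat_eq_real_of_nat vimage_def)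
  also have "ennreal (1 / n) * \<dots> = ennreal (card ({..<n} \<inter> y -` A) / n)"
    by (simp add: ennreal_mult[symmetric])
  also have "\<dots> = emeasure (measure_pmf (pmf_of_set {..<n})) (y -` A)"
    using n by (subst emeasure_pmf_of_set) (auto simp: lessThan_empty_iff)
  also have "\<dots> = emeasure (distr (measure_pmf (pmf_of_set {..<n})) (borel_on M) y) A"
    using y A by (subst emeasure_distr) (auto simp: space_borel_on)
  finally show "emeasure (empirical_measure M y n) A =
      emeasure (distr (measure_pmf (pmf_of_set {..<n})) (borel_on M) y) A" .
qed

lemma empirical_measure_prob:
  assumes "0 < n" "\<And>j. y j \<in> pts M"
  shows "empirical_measure M y n \<in> prob_measures M"
  unfolding prob_measures_def empirical_measure_eq_distr[OF assms]
  using assms(2) by (auto intro!: measure_pmf.prob_space_distr simp: space_borel_on)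

lemma integral_empirical_measure:
  assumes "0 < n" "\<And>j. y j \<in> pts M" "continuous_on (pts M) \<phi>"
  shows "(\<integral>x. \<phi> x \<partial>empirical_measure M y n) = time_average (\<lambda>j. \<phi> (y j)) n"
proof -
  have "(\<integral>x. \<phi> x \<partial>empirical_measure M y n) = (\<integral>j. \<phi> (y j) \<partial>measure_pmf (pmf_of_set {..<n}))"
    unfolding empirical_measure_eq_distr[OF assms(1,2)]
    using assms(2) continuous_borel_on[OF assms(3)]
    by (subst integral_distr) (auto simp: space_borel_on)
  also have "\<dots> = (\<Sum>j<n. \<phi> (y j)) / n"
    using assms(1) by (subst integral_pmf_of_set) (auto simp: lessThan_empty_iff)
  finally show ?thesis
    by (simp add: time_average_def)
qed

text \<open>
A probability measure carried by \<open>{p, q}\<close> is determined by its mass at \<open>q\<close>; the next two lemmas compute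
its integrals and identify it.
\<close>

lemma two_point_integral:
  fixes \<phi> :: "complex \<Rightarrow> real"
  assumes \<mu>: "\<mu> \<in> prob_measures M" and pq: "p \<in> pts M" "q \<in> pts M" "p \<noteq> q"
    and ae: "AE z in \<mu>. z \<in> {p, q}" and \<phi>: "\<phi> \<in> borel_measurable (borel_on M)"
  shows "(\<integral>z. \<phi> z \<partial>\<mu>) = \<phi> p + measure \<mu> {q} * (\<phi> q - \<phi> p)"
proof -
  interpret prob_space \<mu>
    using \<mu> by (simp add: prob_measures_def)
  have sets: "sets \<mu> = sets (borel_on M)"
    using \<mu> by (simp add: prob_measures_def)
  have [measurable]: "{q} \<in> sets \<mu>" "\<phi> \<in> borel_measurable \<mu>"
    using singleton_in_borel_on[OF pq(2)] \<phi> by (simp_all add: sets measurable_cong_sets[OF sets])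
  have "(\<integral>z. \<phi> z \<partial>\<mu>) = (\<integral>z. \<phi> p + indicator {q} z * (\<phi> q - \<phi> p) \<partial>\<mu>)"
    using ae by (intro integral_cong_AE) (auto simp: indicator_def pq(3))
  also have "\<dots> = \<phi> p + measure \<mu> {q} * (\<phi> q - \<phi> p)"
    by (simp add: prob_space emeasure_eq_measure)
  finally show ?thesis .
qed

lemma two_point_eq_convex_comb:
  assumes \<mu>: "\<mu> \<in> prob_measures M" and pq: "p \<in> pts M" "q \<in> pts M" "p \<noteq> q"
    and ae: "AE z in \<mu>. z \<in> {p, q}"
  shows "\<mu> = convex_comb (measure \<mu> {q}) (dirac M q) (dirac M p)"
proof (rule measure_eqI)
  interpret prob_space \<mu>
    using \<mu> by (simp add: prob_measures_def)
  have sets: "sets \<mu> = sets (borel_on M)"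
    using \<mu> by (simp add: prob_measures_def)
  then show "sets \<mu> = sets (convex_comb (measure \<mu> {q}) (dirac M q) (dirac M p))"
    by (simp add: convex_comb_def dirac_def)
  fix A assume A: "A \<in> sets \<mu>"
  then have ind: "indicator A \<in> borel_measurable (borel_on M)"
    by (simp add: sets)
  have "prob A = (\<integral>z. indicator A z \<partial>\<mu>)"
    using A by simp
  also have "\<dots> = indicator A p + prob {q} * (indicator A q - indicator A p)"
    by (rule two_point_integral[OF \<mu> pq ae ind])
  also have "\<dots> = prob {q} * indicator A q + (1 - prob {q}) * indicator A p"
    by (simp add: algebra_simps)
  finally show "emeasure \<mu> A = emeasure (convex_comb (measure \<mu> {q}) (dirac M q) (dirac M p)) A"
    using A sets
    by (simp add: emeasure_convex_comb dirac_def emeasure_eq_measure ennreal_plus ennreal_mult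
      ennreal_indicator)
qed

lemma convex_comb_dirac:
  assumes l: "0 \<le> l" "l \<le> 1" and pq: "p \<in> pts M" "q \<in> pts M" "p \<noteq> q"
  defines "\<mu> \<equiv> convex_comb l (dirac M q) (dirac M p)"
  shows "\<mu> \<in> prob_measures M" "AE z in \<mu>. z \<in> {p, q}" "measure \<mu> {q} = l"
proof -
  have sets: "sets \<mu> = sets (borel_on M)"
    by (simp add: \<mu>_def convex_comb_def dirac_def)
  then have space: "space \<mu> = pts M"
    using sets_eq_imp_space_eq[OF sets] by (simp add: space_borel_on)
  have em: "emeasure \<mu> A = ennreal l * indicator A q + ennreal (1 - l) * indicator A p"
    if "A \<in> sets (borel_on M)" for A
    using that by (simp add: \<mu>_def emeasure_convex_comb dirac_def)
  have "prob_space \<mu>"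
    using em[of "pts M"] pq l sets.top[of "borel_on M"]
    by (intro prob_spaceI) (simp add: space space_borel_on ennreal_plus[symmetric] del: ennreal_plus)
  with sets show "\<mu> \<in> prob_measures M"
    by (simp add: prob_measures_def)
  interpret prob_space \<mu> by fact
  have q: "{q} \<in> sets (borel_on M)" and p: "{p} \<in> sets (borel_on M)"
    using pq by (auto intro: singleton_in_borel_on)
  show "measure \<mu> {q} = l"
    using em[OF q] pq l by (simp add: measure_def)
  have N: "pts M - ({p} \<union> {q}) \<in> sets (borel_on M)"
    using p q by (metis sets.Diff sets.Un sets.top space_borel_on)
  show "AE z in \<mu>. z \<in> {p, q}"
    by (rule AE_I[of _ _ "pts M - ({p} \<union> {q})"]) (use N em[OF N] in \<open>auto simp: space sets\<close>)
qed

text \<open>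
The sets that, if they contain \<open>\<mu>\<close>, contain \<open>\<nu> i\<close> eventually, are closed under finite intersections
and arbitrary unions. So convergence need only be checked on the subbasis generating the topology.
\<close>

lemma weak_star_limitin:
  assumes \<nu>: "\<And>i. \<nu> i \<in> prob_measures M" and \<mu>: "\<mu> \<in> prob_measures M"
    and conv: "\<And>\<phi> :: complex \<Rightarrow> real. continuous_on (pts M) \<phi> \<Longrightarrow>
      ((\<lambda>i. \<integral>x. \<phi> x \<partial>\<nu> i) \<longlongrightarrow> (\<integral>x. \<phi> x \<partial>\<mu>)) F"
  shows "limitin (weak_star_topology M) \<nu> \<mu> F"
  unfolding limitin_def topspace_weak_star
proof (intro conjI \<mu> allI impI)
  fix U assume "openin (weak_star_topology M) U \<and> \<mu> \<in> U"
  then have "generate_topology_on {{\<mu> \<in> prob_measures M. (\<integral>x. \<phi> x \<partial>\<mu>) \<in> U} | (\<phi> :: complex \<Rightarrow> real) U.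
        continuous_on (pts M) \<phi> \<and> open U} U" and "\<mu> \<in> U"
    by (auto simp: weak_star_topology_def openin_topology_generated_by_iff)
  then show "\<forall>\<^sub>F i in F. \<nu> i \<in> U"
  proof (induction rule: generate_topology_on.induct)
    case (Int a b)
    then show ?case
      by (auto intro: eventually_conj)
  next
    case (UN K)
    then obtain k where k: "k \<in> K" "\<mu> \<in> k"
      by auto
    then have "\<forall>\<^sub>F i in F. \<nu> i \<in> k"
      using UN.IH by blast
    then show ?case
      by eventually_elim (use k in auto)
  next
    case (Basis s)
    then obtain \<phi> :: "complex \<Rightarrow> real" and V where s: "s = {\<mu> \<in> prob_measures M. (\<integral>x. \<phi> x \<partial>\<mu>) \<in> V}"
      "continuous_on (pts M) \<phi>" "open V"
      by auto
    then have "\<forall>\<^sub>F i in F. (\<integral>x. \<phi> x \<partial>\<nu> i) \<in> V"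
      using conv[OF s(2)] Basis.prems by (auto simp: tendsto_def)
    then show ?case
      by eventually_elim (use \<nu> s in auto)
  qed simp
qed

lemma openin_weak_star:
  fixes \<phi> :: "complex \<Rightarrow> real"
  assumes "continuous_on (pts M) \<phi>" "open V"
  shows "openin (weak_star_topology M) {\<mu> \<in> prob_measures M. (\<integral>x. \<phi> x \<partial>\<mu>) \<in> V}"
  unfolding weak_star_topology_def
  by (intro topology_generated_by_Basis) (use assms in blast)

text \<open>
If the time averages are those of a moving mixture of two points whose weights \<open>A\<^sub>n\<close> accumulate
everywhere in \<open>[0,1]\<close>, then all mixtures are limit points, along subsequences of \<open>A\<^sub>n\<close>. Conversely a
limit point gives integral 0 to the test function \<open>|z - p| |z - q|\<close>, whose average along the mixtures
vanishes, so it is itself a mixture.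
\<close>

lemma empirical_limit_points:
  assumes pq: "p \<in> pts M" "q \<in> pts M" "p \<noteq> q" and y: "\<And>j. y j \<in> pts M"
    and avg: "\<And>\<phi> :: complex \<Rightarrow> real. continuous_on (pts M) \<phi> \<Longrightarrow>
      (\<lambda>n. time_average (\<lambda>j. \<phi> (y j)) n - (\<phi> p + A n * (\<phi> q - \<phi> p))) \<longlonglongrightarrow> 0"
    and A: "\<And>n. 0 \<le> A n" "\<And>n. A n \<le> 1"
    and near: "\<And>l e. 0 \<le> l \<Longrightarrow> l \<le> 1 \<Longrightarrow> 0 < e \<Longrightarrow> \<exists>\<^sub>F n in sequentially. \<bar>A n - l\<bar> \<le> e"
  shows "{\<mu> \<in> topspace (weak_star_topology M).
      \<forall>U. openin (weak_star_topology M) U \<and> \<mu> \<in> U \<longrightarrow>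
        (\<exists>\<^sub>F n in sequentially. empirical_measure M y n \<in> U)} =
      {convex_comb l (dirac M q) (dirac M p) | l. l \<in> {0..1}}" (is "?L = ?R")
proof (intro equalityI subsetI)
  fix \<mu> assume "\<mu> \<in> ?R"
  then obtain l where l: "0 \<le> l" "l \<le> 1" and \<mu>: "\<mu> = convex_comb l (dirac M q) (dirac M p)"
    by auto
  note cc = convex_comb_dirac[OF l pq, folded \<mu>]
  have "\<exists>n\<ge>Suc i. \<bar>A n - l\<bar> \<le> 1 / Suc i" for i
    using near[OF l, of "1 / Suc i"] by (simp add: frequently_sequentially)
  then obtain r where r: "\<And>i. Suc i \<le> r i" "\<And>i. \<bar>A (r i) - l\<bar> \<le> 1 / Suc i"
    by metis
  have r_top: "filterlim r at_top sequentially"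
    by (rule filterlim_at_top_mono[OF filterlim_Suc]) (use r(1) in auto)
  have "(\<lambda>i. A (r i) - l) \<longlonglongrightarrow> 0"
    by (rule Lim_null_comparison[OF _ LIMSEQ_inverse_real_of_nat])
       (use r(2) in \<open>auto simp: inverse_eq_divide\<close>)
  then have Ar: "(\<lambda>i. A (r i)) \<longlonglongrightarrow> l"
    by (simp add: LIM_zero_iff)
  have r0: "0 < r i" for i
    using r(1)[of i] by simp
  have lim: "limitin (weak_star_topology M) (\<lambda>i. empirical_measure M y (r i)) \<mu> sequentially"
  proof (rule weak_star_limitin[OF empirical_measure_prob[OF r0 y] cc(1)])
    fix \<phi> :: "complex \<Rightarrow> real" assume \<phi>: "continuous_on (pts M) \<phi>"
    have "(\<lambda>i. (time_average (\<lambda>j. \<phi> (y j)) (r i) - (\<phi> p + A (r i) * (\<phi> q - \<phi> p))) +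
        (\<phi> p + A (r i) * (\<phi> q - \<phi> p))) \<longlonglongrightarrow> 0 + (\<phi> p + l * (\<phi> q - \<phi> p))"
      by (intro tendsto_intros filterlim_compose[OF avg[OF \<phi>] r_top] Ar)
    then show "(\<lambda>i. \<integral>x. \<phi> x \<partial>empirical_measure M y (r i)) \<longlonglongrightarrow> (\<integral>x. \<phi> x \<partial>\<mu>)"
      by (simp add: integral_empirical_measure[OF r0 y \<phi>]
          two_point_integral[OF cc(1) pq cc(2) continuous_borel_on[OF \<phi>]] cc(3))
  qed
  have "\<exists>\<^sub>F n in sequentially. empirical_measure M y n \<in> U"
    if U: "openin (weak_star_topology M) U" "\<mu> \<in> U" for U
    unfolding frequently_sequentially
  proof
    fix N
    have "\<forall>\<^sub>F i in sequentially. empirical_measure M y (r i) \<in> U \<and> N \<le> r i"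
      using lim U r_top by (auto simp: limitin_def filterlim_at_top intro: eventually_conj)
    then obtain i where "empirical_measure M y (r i) \<in> U" "N \<le> r i"
      by (auto dest: eventually_happens)
    then show "\<exists>n\<ge>N. empirical_measure M y n \<in> U"
      by blast
  qed
  then show "\<mu> \<in> ?L"
    using cc(1) by (auto simp: topspace_weak_star)
next
  fix \<mu> assume \<mu>_L: "\<mu> \<in> ?L"
  then have \<mu>: "\<mu> \<in> prob_measures M"
    by (simp add: topspace_weak_star)
  then interpret prob_space \<mu>
    by (simp add: prob_measures_def)
  have sets: "sets \<mu> = sets (borel_on M)"
    using \<mu> by (simp add: prob_measures_def)
  \<comment> \<open>the integral of \<open>\<phi>\<close> against a limit point is a limit point of its integrals against the mixtures\<close>
  have approx: "\<exists>\<^sub>F n in sequentially. \<bar>(\<phi> p + A n * (\<phi> q - \<phi> p)) - (\<integral>x. \<phi> x \<partial>\<mu>)\<bar> < e"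
    if \<phi>: "continuous_on (pts M) \<phi>" and e: "0 < e" for \<phi> :: "complex \<Rightarrow> real" and e
  proof -
    let ?U = "{\<nu> \<in> prob_measures M. (\<integral>x. \<phi> x \<partial>\<nu>) \<in> ball (\<integral>x. \<phi> x \<partial>\<mu>) (e / 2)}"
    have "openin (weak_star_topology M) ?U"
      by (intro openin_weak_star \<phi>) simp
    then have "\<exists>\<^sub>F n in sequentially. empirical_measure M y n \<in> ?U"
      using \<mu>_L \<mu> e by (elim CollectE conjE allE[of _ ?U]) simp
    moreover have "\<forall>\<^sub>F n in sequentially. \<bar>time_average (\<lambda>j. \<phi> (y j)) n - (\<phi> p + A n * (\<phi> q - \<phi> p))\<bar> < e / 2 \<and> 0 < n"
      using tendstoD[OF avg[OF \<phi>], of "e / 2"] e eventually_gt_at_top[of 0]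
      by (auto simp: dist_real_def intro: eventually_conj)
    ultimately have "\<exists>\<^sub>F n in sequentially. empirical_measure M y n \<in> ?U \<and>
        (\<bar>time_average (\<lambda>j. \<phi> (y j)) n - (\<phi> p + A n * (\<phi> q - \<phi> p))\<bar> < e / 2 \<and> 0 < n)"
      by (rule frequently_eventually_frequently)
    then show ?thesis
    proof (rule frequently_elim1)
      fix n assume n: "empirical_measure M y n \<in> ?U \<and>
        (\<bar>time_average (\<lambda>j. \<phi> (y j)) n - (\<phi> p + A n * (\<phi> q - \<phi> p))\<bar> < e / 2 \<and> 0 < n)"
      then have "(\<integral>x. \<phi> x \<partial>empirical_measure M y n) = time_average (\<lambda>j. \<phi> (y j)) n"
        by (intro integral_empirical_measure y \<phi>) auto
      with n have "\<bar>time_average (\<lambda>j. \<phi> (y j)) n - (\<integral>x. \<phi> x \<partial>\<mu>)\<bar> < e / 2"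
        by (auto simp: dist_real_def abs_minus_commute)
      with n show "\<bar>(\<phi> p + A n * (\<phi> q - \<phi> p)) - (\<integral>x. \<phi> x \<partial>\<mu>)\<bar> < e"
        by linarith
    qed
  qed
  define \<phi> where "\<phi> z = dist z p * dist z q" for z :: complex
  have cont: "continuous_on (pts M) \<phi>"
    unfolding \<phi>_def by (intro continuous_intros)
  have "\<bar>\<integral>x. \<phi> x \<partial>\<mu>\<bar> < e" if "0 < e" for e
    using approx[OF cont that] by (auto simp: \<phi>_def dest: frequently_ex)
  then have "(\<integral>x. \<phi> x \<partial>\<mu>) = 0"
    by (metis abs_not_less_zero less_irrefl zero_less_abs_iff)
  moreover have "integrable \<mu> \<phi>"
  proof -
    obtain B where B: "\<And>z. z \<in> pts M \<Longrightarrow> \<bar>\<phi> z\<bar> \<le> B"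
      using compact_imp_bounded[OF compact_continuous_image[OF cont compact_pts]]
      by (auto simp: bounded_iff)
    have "space \<mu> = pts M"
      using sets_eq_imp_space_eq[OF sets] by (simp add: space_borel_on)
    then show ?thesis
      using B continuous_borel_on[OF cont]
      by (intro integrable_const_bound[of _ B]) (auto simp: measurable_cong_sets[OF sets])
  qed
  ultimately have "AE z in \<mu>. \<phi> z = 0"
    by (subst (asm) integral_nonneg_eq_0_iff_AE) (auto simp: \<phi>_def)
  then have ae: "AE z in \<mu>. z \<in> {p, q}"
    by eventually_elim (auto simp: \<phi>_def)
  from two_point_eq_convex_comb[OF \<mu> pq ae]
  show "\<mu> \<in> ?R"
    by (intro CollectI exI[of _ "measure \<mu> {q}"]) (auto intro: prob_le_1)
qed

section \<open>Monotone interval maps\<close>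

lemma no_zero_constant_sign:
  fixes f :: "real \<Rightarrow> real"
  assumes cont: "continuous_on {a<..<b} f" and nz: "\<And>x. x \<in> {a<..<b} \<Longrightarrow> f x \<noteq> 0"
  shows "(\<forall>x\<in>{a<..<b}. 0 < f x) \<or> (\<forall>x\<in>{a<..<b}. f x < 0)"
proof (rule ccontr)
  assume "\<not> ?thesis"
  then obtain x y where xy: "x \<in> {a<..<b}" "f x \<le> 0" "y \<in> {a<..<b}" "0 \<le> f y"
    by (auto simp: not_less)
  have "connected (f ` {a<..<b})"
    by (intro connected_continuous_image cont) auto
  then have "{f x..f y} \<subseteq> f ` {a<..<b}"
    using xy by (intro connected_contains_Icc) auto
  then have "0 \<in> f ` {a<..<b}"
    using xy by auto
  with nz show False
    by auto
qed

lemma integer_valued_constant: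
  fixes f :: "real \<Rightarrow> real"
  assumes "continuous_on UNIV f" "\<And>x. f x \<in> \<int>"
  shows "f x = f y"
proof -
  have "f constant_on UNIV"
  proof (rule continuous_discrete_range_constant)
    show "\<exists>e>0. \<forall>y. y \<in> UNIV \<and> f y \<noteq> f x \<longrightarrow> e \<le> norm (f y - f x)" for x
    proof (intro exI[of _ 1] conjI allI impI)
      fix y assume "y \<in> UNIV \<and> f y \<noteq> f x"
      moreover have "f y - f x \<in> \<int>"
        using assms(2) by auto
      ultimately show "1 \<le> norm (f y - f x)"
        using Ints_nonzero_abs_ge1[of "f y - f x"] by simp
    qed simp
  qed (use assms in auto)
  then show ?thesis
    by (auto simp: constant_on_def)
qed

text \<open>
The sign of \<open>G v - v\<close> is constant on the open interval, so every two-sided orbit is monotone; its limits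
are fixed points and can only be the end points.
\<close>

lemma monotone_interval_orbit:
  fixes G :: "real \<Rightarrow> real"
  assumes cont: "continuous_on {s..t} G" and mono: "strict_mono_on {s..t} G"
    and fix_s: "G s = s" and fix_t: "G t = t"
    and no_fix: "\<And>v. v \<in> {s<..<t} \<Longrightarrow> G v \<noteq> v" and u: "u \<in> {s<..<t}"
  obtains H :: "int \<Rightarrow> real" where "H 0 = u" "\<And>k. H k \<in> {s<..<t}" "\<And>k. G (H k) = H (k + 1)"
    "(\<lambda>n. H (int n)) \<longlonglongrightarrow> t \<and> (\<lambda>n. H (- int n)) \<longlonglongrightarrow> s \<or>
     (\<lambda>n. H (int n)) \<longlonglongrightarrow> s \<and> (\<lambda>n. H (- int n)) \<longlonglongrightarrow> t"
proof -
  let ?I = "{s<..<t}"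
  have maps: "G v \<in> ?I" if "v \<in> ?I" for v
    using strict_mono_onD[OF mono, of s v] strict_mono_onD[OF mono, of v t] that fix_s fix_t by auto
  have onto: "\<exists>v\<in>?I. G v = w" if "w \<in> ?I" for w
  proof -
    have "\<exists>v\<ge>s. v \<le> t \<and> G v = w"
      using that fix_s fix_t cont by (intro IVT') auto
    then show ?thesis
      using that fix_s fix_t by (metis greaterThanLessThan_iff less_eq_real_def less_irrefl)
  qed
  define Gi where "Gi w = (SOME v. v \<in> ?I \<and> G v = w)" for w
  have Gi: "Gi w \<in> ?I" "G (Gi w) = w" if "w \<in> ?I" for w
    using someI_ex[of "\<lambda>v. v \<in> ?I \<and> G v = w"] onto[OF that] unfolding Gi_def by blast+
  \<comment> \<open>the two-sided orbit of \<open>u\<close>; \<open>Gi\<close> is a right inverse of \<open>G\<close> on the open interval\<close>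
  define H where "H k = (if 0 \<le> k then (G ^^ nat k) u else (Gi ^^ nat (- k)) u)" for k :: int
  have fwd: "(G ^^ n) u \<in> ?I" and bwd: "(Gi ^^ n) u \<in> ?I" for n
    by (induction n) (use u maps Gi(1) in auto)
  have H_I: "H k \<in> ?I" for k
    using fwd bwd by (simp add: H_def)
  have H_step: "G (H k) = H (k + 1)" for k
  proof (cases "0 \<le> k")
    case True
    then show ?thesis
      by (simp add: H_def nat_add_distrib)
  next
    case False
    then obtain m where m: "k = - int (Suc m)"
      by (metis int_cases not_le_imp_less of_nat_0_le_iff)
    then show ?thesis
      using Gi(2)[OF bwd[of m]] by (auto simp: H_def nat_add_distrib)
  qed
  have lim: "\<exists>L. X \<longlonglongrightarrow> L \<and> (L = s \<or> L = t)"
    if X: "monoseq X" "\<And>n. X n \<in> ?I"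
      and orb: "(\<forall>n. G (X n) = X (Suc n)) \<or> (\<forall>n. G (X (Suc n)) = X n)" for X :: "nat \<Rightarrow> real"
  proof -
    have "Bseq X"
      using X(2) by (intro BseqI'[of _ "\<bar>s\<bar> + \<bar>t\<bar>"]) (smt (verit) greaterThanLessThan_iff real_norm_def)
    then obtain L where L: "X \<longlonglongrightarrow> L"
      using Bseq_monoseq_convergent[OF _ X(1)] by (auto simp: convergent_def)
    have L_I: "L \<in> {s..t}"
      using X(2) by (intro closed_sequentially[OF _ _ L]) (auto intro: less_imp_le)
    have "(\<lambda>n. G (X n)) \<longlonglongrightarrow> G L"
      using X(2) by (intro continuous_on_tendsto_compose[OF cont L L_I])
        (auto intro!: always_eventually less_imp_le)
    then have "G L = L"
      using orb
    proof (elim disjE)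
      assume GX: "(\<lambda>n. G (X n)) \<longlonglongrightarrow> G L" "\<forall>n. G (X n) = X (Suc n)"
      then show "G L = L"
        using LIMSEQ_unique[of "\<lambda>n. X (Suc n)"] LIMSEQ_Suc[OF L] by simp
    next
      assume GX: "(\<lambda>n. G (X n)) \<longlonglongrightarrow> G L" "\<forall>n. G (X (Suc n)) = X n"
      then have "X \<longlonglongrightarrow> G L"
        using LIMSEQ_Suc[OF GX(1)] by simp
      then show "G L = L"
        using L by (rule LIMSEQ_unique)
    qed
    then show ?thesis
      using L L_I no_fix[of L] by fastforce
  qed
  have inc: "X \<longlonglongrightarrow> t" if X: "incseq X" "\<And>n. X n \<in> ?I"
      "(\<forall>n. G (X n) = X (Suc n)) \<or> (\<forall>n. G (X (Suc n)) = X n)" for X :: "nat \<Rightarrow> real"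
  proof -
    obtain L where L: "X \<longlonglongrightarrow> L" "L = s \<or> L = t"
      using lim[OF _ X(2,3)] X(1) by (auto simp: monoseq_iff)
    then show ?thesis
      using incseq_le[OF X(1) L(1), of 0] X(2)[of 0] by auto
  qed
  have dec: "X \<longlonglongrightarrow> s" if X: "decseq X" "\<And>n. X n \<in> ?I"
      "(\<forall>n. G (X n) = X (Suc n)) \<or> (\<forall>n. G (X (Suc n)) = X n)" for X :: "nat \<Rightarrow> real"
  proof -
    obtain L where L: "X \<longlonglongrightarrow> L" "L = s \<or> L = t"
      using lim[OF _ X(2,3)] X(1) by (auto simp: monoseq_iff)
    then show ?thesis
      using decseq_ge[OF X(1) L(1), of 0] X(2)[of 0] by auto
  qed
  have orb_f: "\<forall>n. G (H (int n)) = H (int (Suc n))"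
    using H_step by (simp add: add.commute)
  have orb_b: "\<forall>n. G (H (- int (Suc n))) = H (- int n)"
    using H_step by simp
  have "(\<forall>v\<in>?I. 0 < G v - v) \<or> (\<forall>v\<in>?I. G v - v < 0)"
    using no_fix by (intro no_zero_constant_sign continuous_intros continuous_on_subset[OF cont]) auto
  then have "(\<lambda>n. H (int n)) \<longlonglongrightarrow> t \<and> (\<lambda>n. H (- int n)) \<longlonglongrightarrow> s \<or>
     (\<lambda>n. H (int n)) \<longlonglongrightarrow> s \<and> (\<lambda>n. H (- int n)) \<longlonglongrightarrow> t"
  proof
    assume "\<forall>v\<in>?I. 0 < G v - v"
    then have up: "H k \<le> H (k + 1)" for k
      using H_I[of k] H_step[of k] by (metis diff_gt_0_iff_gt less_imp_le)
    have "incseq (\<lambda>n. H (int n))"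
      using up[of "int n" for n] by (intro incseq_SucI) (simp add: add.commute[of 1])
    moreover have "decseq (\<lambda>n. H (- int n))"
      using up[of "- int (Suc n)" for n] by (intro decseq_SucI) simp
    ultimately show ?thesis
      using inc[of "\<lambda>n. H (int n)"] dec[of "\<lambda>n. H (- int n)"] orb_f orb_b H_I by blast
  next
    assume "\<forall>v\<in>?I. G v - v < 0"
    then have down: "H (k + 1) \<le> H k" for k
      using H_I[of k] H_step[of k] by (metis diff_less_0_iff_less less_imp_le)
    have "decseq (\<lambda>n. H (int n))"
      using down[of "int n" for n] by (intro decseq_SucI) (simp add: add.commute[of 1])
    moreover have "incseq (\<lambda>n. H (- int n))"
      using down[of "- int (Suc n)" for n] by (intro incseq_SucI) simp
    ultimately show ?thesis
      using dec[of "\<lambda>n. H (int n)"] inc[of "\<lambda>n. H (- int n)"] orb_f orb_b H_I by blast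
  qed
  moreover have "H 0 = u"
    by (simp add: H_def)
  ultimately show ?thesis
    using H_I H_step that by blast
qed

section \<open>Lifts of diffeomorphisms\<close>

lemma closed_pdom: "closed (pdom M)" and convex_pdom: "is_interval (pdom M)"
  by (cases M; simp add: is_interval_univ is_interval_cc)+

lemma continuous_on_param: "continuous_on A (param M)"
  by (cases M) (auto simp: cis_conv_exp intro!: continuous_intros)

lemma param_in_pts: "u \<in> pdom M \<Longrightarrow> param M u \<in> pts M"
  by (simp add: pts_def)

lemma lift_ofD:
  assumes "lift_of M T g" "t \<in> pdom M"
  shows "g t \<in> pdom M" "param M (g t) = T (param M t)"
  using assms by (auto simp: lift_of_def)

lemma C1_map_continuous_lift:
  assumes "C1_map M T"
  obtains g where "lift_of M T g" "continuous_on (pdom M) g"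
proof -
  obtain g g' where "lift_of M T g"
      "\<forall>t\<in>pdom M. (g has_real_derivative g' t) (at t within pdom M)"
    using assms by (auto simp: C1_map_def)
  then show ?thesis
    using that by (metis DERIV_continuous_on)
qed

text \<open>
The integer \<open>e\<close> is the degree of the circle map: \<open>g (v + 1) - g v\<close> is an integer that depends
continuously on \<open>v\<close>.
\<close>

lemma circle_lift_translate:
  assumes g: "lift_of Circle T g" "continuous_on UNIV g"
  obtains e where "e \<in> \<int>" "\<And>v n. n \<in> \<int> \<Longrightarrow> g (v + n) = g v + e * n"
proof -
  have shift: "g (v + 1) - g v \<in> \<int>" for v
  proof -
    have "param Circle (v + 1) = param Circle v"
      by (subst param_Circle_eq_iff) simp
    then have "param Circle (g (v + 1)) = param Circle (g v)"
      using lift_ofD(2)[OF g(1)] by (metis UNIV_I pdom.simps(1))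
    then show ?thesis
      by (simp only: param_Circle_eq_iff)
  qed
  define e where "e = g 1 - g 0"
  have "continuous_on UNIV (\<lambda>v. g (v + 1) - g v)"
    by (intro continuous_intros continuous_on_compose2[OF g(2)]) auto
  from integer_valued_constant[OF this shift, of _ 0]
  have 1: "g (v + 1) = g v + e" for v
    unfolding e_def by (simp add: algebra_simps) (metis add.commute)
  have nat: "g (v + real n) = g v + e * n" for v n
  proof (induction n)
    case (Suc n)
    then show ?case
      using 1[of "v + real n"] by (simp add: algebra_simps)
  qed simp
  have "g (v + n) = g v + e * n" if n: "n \<in> \<int>" for v n
  proof -
    obtain m where m: "n = of_int m"
      using n by (auto elim: Ints_cases)
    show ?thesis
    proof (cases "0 \<le> m")
      case True
      then show ?thesis
        using nat[of v "nat m"] m by simp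
    next
      case False
      then show ?thesis
        using nat[of "v + n" "nat (- m)"] m by (simp add: algebra_simps)
    qed
  qed
  moreover have "e \<in> \<int>"
    using shift[of 0] by (simp add: e_def)
  ultimately show ?thesis
    using that by blast
qed

text \<open>
Let \<open>h\<close> be a lift of the inverse. Then \<open>h \<circ> g\<close> lifts the identity and so, by continuity, is a
translation by an integer. This makes \<open>g\<close> injective, hence monotone, and on the circle the degrees of \<open>g\<close> and \<open>h\<close>
multiply to 1.
\<close>

lemma diffeomorphism_monotone_lift:
  assumes T: "diffeomorphism M T"
  obtains g where "lift_of M T g" "continuous_on (pdom M) g"
    "strict_mono_on (pdom M) g \<or> strict_antimono_on (pdom M) g"
    "M = Circle \<Longrightarrow> \<exists>e. \<bar>e\<bar> = 1 \<and> (\<forall>v. \<forall>n\<in>\<int>. g (v + n) = g v + e * n)"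
proof -
  have bij: "bij_betw T (pts M) (pts M)"
    using T by (simp add: diffeomorphism_def)
  obtain g where g: "lift_of M T g" "continuous_on (pdom M) g"
    using T C1_map_continuous_lift by (auto simp: diffeomorphism_def)
  obtain h where h: "lift_of M (inv_into (pts M) T) h" "continuous_on (pdom M) h"
    using T C1_map_continuous_lift by (auto simp: diffeomorphism_def)
  have hg: "param M (h (g v)) = param M v" if "v \<in> pdom M" for v
    using that bij lift_ofD[OF g(1)] lift_ofD[OF h(1)] param_in_pts[OF that]
    by (simp add: bij_betw_def inv_into_f_f)
  have "inj_on g (pdom M) \<and>
      (M = Circle \<longrightarrow> (\<exists>e. \<bar>e\<bar> = 1 \<and> (\<forall>v. \<forall>n\<in>\<int>. g (v + n) = g v + e * n)))"
  proof (cases M)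
    case Interval
    then have "h (g v) = v" if "v \<in> pdom M" for v
      using hg[OF that] by simp
    then have "inj_on g (pdom M)"
      by (rule inj_on_inverseI[of _ h])
    then show ?thesis
      using Interval by simp
  next
    case Circle
    note [simp] = Circle
    have cg: "continuous_on UNIV g" and ch: "continuous_on UNIV h"
      using g(2) h(2) by simp_all
    have "continuous_on UNIV (\<lambda>v. h (g v) - v)"
      by (intro continuous_intros continuous_on_compose2[OF ch cg]) auto
    moreover have "h (g v) - v \<in> \<int>" for v
      using hg[of v] param_Circle_eq_iff by simp
    ultimately have "h (g v) - v = h (g 0) - 0" for v
      by (rule integer_valued_constant)
    then have hg': "h (g v) = v + h (g 0)" for v
      by (metis add.commute diff_zero eq_diff_eq)
    have "inj g"
      by (rule inj_onI) (metis add_right_cancel hg')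
    obtain e where e: "e \<in> \<int>" "\<And>v n. n \<in> \<int> \<Longrightarrow> g (v + n) = g v + e * n"
      using circle_lift_translate[of T g] g(1) cg by auto
    obtain e' where e': "e' \<in> \<int>" "\<And>v n. n \<in> \<int> \<Longrightarrow> h (v + n) = h v + e' * n"
      using circle_lift_translate[of _ h] h(1) ch by auto
    have "h (g 1) = h (g 0) + e' * e"
      using e(2)[of 1 0] e'(2)[OF e(1), of "g 0"] by simp
    then have "e' * e = 1"
      using hg'[of 1] by simp
    moreover obtain m m' where "e = of_int m" "e' = of_int m'"
      using e(1) e'(1) by (auto elim!: Ints_cases)
    ultimately have "m' * m = 1"
      by (metis of_int_1 of_int_eq_iff of_int_mult)
    then have "\<bar>m\<bar> = 1"
      by (metis abs_mult abs_zmult_eq_1 mult.commute abs_1)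
    then have "\<bar>e\<bar> = 1"
      using \<open>e = of_int m\<close> by linarith
    with e(2) \<open>inj g\<close> show ?thesis
      by auto
  qed
  moreover have "strict_mono_on (pdom M) g \<or> strict_antimono_on (pdom M) g"
    using calculation injective_eq_monotone_map[OF convex_pdom g(2)] by blast
  ultimately show ?thesis
    using that[OF g] by blast
qed

text \<open>
Two lifts of the same map differ by integers, so their difference is locally constant wherever it is
continuous. This is used with \<open>f\<close> a translated lift, and with \<open>f\<close> the identity on the fixed points.
\<close>

lemma lift_eq_near:
  assumes g: "lift_of M T g" and F: "\<And>v. v \<in> F \<Longrightarrow> v \<in> pdom M \<and> param M (f v) = T (param M v)"
    and u: "u \<in> F" and range: "\<And>v. v \<in> F \<Longrightarrow> f v \<in> pdom M"
    and cont: "continuous (at u within F) (\<lambda>v. g v - f v)"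
  shows "\<forall>\<^sub>F v in at u within F. g v - f v = g u - f u"
proof -
  have int: "g v - f v \<in> \<int>" if "v \<in> F" for v
  proof -
    have "param M (g v) = param M (f v)"
      using lift_ofD(2)[OF g] F[OF that] by simp
    then show ?thesis
      by (cases M) (simp_all only: param_Circle_eq_iff, simp)
  qed
  have "\<forall>\<^sub>F v in at u within F. dist (g v - f v) (g u - f u) < 1"
    using cont by (intro tendstoD) (simp_all add: continuous_within)
  moreover have "\<forall>\<^sub>F v in at u within F. v \<in> F"
    by (simp add: eventually_at_filter)
  ultimately show ?thesis
  proof eventually_elim
    case (elim v)
    then show ?case
      using Ints_nonzero_abs_less1[of "(g v - f v) - (g u - f u)"] int[OF elim(2)] int[OF u]
      by (auto simp: dist_real_def)
  qed
qed

section \<open>Morse--Smale maps between consecutive fixed points\<close>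

locale morse_smale =
  fixes M :: one_manifold and T :: "complex \<Rightarrow> complex"
  assumes morse_smale: "morse_smale_period_one M T"
begin

lemma bij: "bij_betw T (pts M) (pts M)"
  using morse_smale by (simp add: morse_smale_period_one_def diffeomorphism_def)

lemma fixed_of_square:
  assumes "x \<in> pts M" "T (T x) = x"
  shows "fixed_point M T x"
proof -
  have "(T ^^ 2) x = x"
    using assms(2) by (simp add: numeral_2_eq_2)
  then have "periodic_point M T x"
    unfolding periodic_point_def using assms(1) by (intro conjI exI[of _ 2]) auto
  then show ?thesis
    using morse_smale by (auto simp: morse_smale_period_one_def fixed_sink_def fixed_source_def)
qed

text \<open>
The derivative at a sink or source is that of some lift over some base point, possibly discontinuous
elsewhere. Near the base point that lift is a translate of the continuous lift \<open>g\<close>, so the derivative is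
also the one of \<open>g\<close>.
\<close>

lemma lift_hyperbolic:
  assumes g: "lift_of M T g" "continuous_on (pdom M) g"
    and u: "u \<in> pdom M" "fixed_point M T (param M u)"
  obtains d where "\<bar>d\<bar> \<noteq> 1" "(g has_real_derivative d) (at u within pdom M)"
proof -
  have "periodic_point M T (param M u)"
    using u(2) unfolding periodic_point_def fixed_point_def by (intro conjI exI[of _ 1]) auto
  then obtain d where d: "has_deriv_at M T d (param M u)" "\<bar>d\<bar> \<noteq> 1"
    using morse_smale by (force simp: morse_smale_period_one_def fixed_sink_def fixed_source_def)
  then obtain f t where f: "lift_of M T f" "t \<in> pdom M" "param M t = param M u"
      "(f has_real_derivative d) (at t within pdom M)"
    by (auto simp: has_deriv_at_def)
  have "(g has_real_derivative d) (at u within pdom M)"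
  proof (cases M)
    case Interval
    then have [simp]: "t = u"
      using f(3) by simp
    have "g v = f v" if "v \<in> pdom M" for v
      using lift_ofD(2)[OF g(1) that] lift_ofD(2)[OF f(1) that] Interval
      by (metis of_real_eq_iff param.simps(2))
    then show ?thesis
      using f(4) u(1) by (intro has_field_derivative_transform_within[of f d u "pdom M" 1 g]) simp_all
  next
    case Circle
    define n where "n = t - u"
    have n: "n \<in> \<int>"
      using f(3) by (simp only: n_def Circle param_Circle_eq_iff)
    have f': "((\<lambda>v. f (v + n)) has_real_derivative d) (at u)"
      using f(4) Circle by (simp add: n_def flip: DERIV_shift)
    have "\<forall>\<^sub>F v in at u within UNIV. g v - f (v + n) = g u - f (u + n)"
    proof (rule lift_eq_near[OF g(1)])
      fix v :: real
      have "param M (v + n) = param M v"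
        using n Circle by (simp only: param_Circle_eq_iff) simp
      then show "v \<in> pdom M \<and> param M (f (v + n)) = T (param M v)"
        using lift_ofD(2)[OF f(1), of "v + n"] Circle by simp
    next
      have "continuous (at u) g"
        using g(2) Circle by (simp add: continuous_on_eq_continuous_at)
      then show "continuous (at u within UNIV) (\<lambda>v. g v - f (v + n))"
        using DERIV_isCont[OF f'] by (intro continuous_intros) auto
    qed (use Circle in auto)
    then have "\<forall>\<^sub>F v in nhds u. g v = f (v + n) + (g u - f (u + n))"
      by (auto simp: eventually_nhds_conv_at algebra_simps elim: eventually_mono)
    moreover have "((\<lambda>v. f (v + n) + (g u - f (u + n))) has_real_derivative d) (at u)"
      using f' by (auto intro!: derivative_eq_intros)
    ultimately show ?thesis
      using Circle by (simp add: DERIV_cong_ev)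
  qed
  with d(2) that show ?thesis
    by blast
qed

definition fixed_params :: "real set" where
  "fixed_params = {u \<in> pdom M. fixed_point M T (param M u)}"

lemma continuous_lift:
  obtains g where "lift_of M T g" "continuous_on (pdom M) g"
  using morse_smale C1_map_continuous_lift
  by (auto simp: morse_smale_period_one_def diffeomorphism_def)

lemma closed_fixed_params: "closed fixed_params"
proof -
  obtain g where g: "lift_of M T g" "continuous_on (pdom M) g"
    by (rule continuous_lift)
  have "closed (pdom M \<inter> (\<lambda>u. param M (g u) - param M u) -` {0})"
    by (intro continuous_closed_preimage closed_pdom continuous_intros
        continuous_on_compose2[OF continuous_on_param g(2)] continuous_on_param) auto
  also have "pdom M \<inter> (\<lambda>u. param M (g u) - param M u) -` {0} = fixed_params"
    using lift_ofD(2)[OF g(1)] by (auto simp: fixed_params_def fixed_point_def param_in_pts)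
  finally show ?thesis .
qed

text \<open>
Along fixed points that accumulate at \<open>u\<close> the difference quotients of a lift are eventually equal to 1,
which contradicts hyperbolicity.
\<close>

lemma fixed_params_isolated:
  assumes u: "u \<in> fixed_params"
  shows "\<not> u islimpt fixed_params"
proof
  assume "u islimpt fixed_params"
  then have nontriv: "at u within fixed_params \<noteq> bot"
    by (simp add: trivial_limit_within)
  obtain g where g: "lift_of M T g" "continuous_on (pdom M) g"
    by (rule continuous_lift)
  obtain d where d: "\<bar>d\<bar> \<noteq> 1" "(g has_real_derivative d) (at u within pdom M)"
    using lift_hyperbolic[OF g] u by (auto simp: fixed_params_def)
  have d': "(g has_real_derivative d) (at u within fixed_params)"
    using d(2) by (rule DERIV_subset) (auto simp: fixed_params_def)
  have "\<forall>\<^sub>F v in at u within fixed_params. g v - v = g u - u"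
  proof (rule lift_eq_near[OF g(1)])
    show "continuous (at u within fixed_params) (\<lambda>v. g v - v)"
      using DERIV_continuous[OF d'] by (intro continuous_intros)
  qed (use u in \<open>auto simp: fixed_params_def fixed_point_def\<close>)
  moreover have "\<forall>\<^sub>F v in at u within fixed_params. v \<noteq> u"
    by (simp add: eventually_at_filter)
  ultimately have "\<forall>\<^sub>F v in at u within fixed_params. (g v - g u) / (v - u) = 1"
    by eventually_elim (auto simp: field_simps)
  then have "((\<lambda>v. (g v - g u) / (v - u)) \<longlongrightarrow> 1) (at u within fixed_params)"
    by (rule tendsto_eventually)
  moreover have "((\<lambda>v. (g v - g u) / (v - u)) \<longlongrightarrow> d) (at u within fixed_params)"
    using d' by (simp add: has_field_derivative_iff)
  ultimately have "d = 1"
    using tendsto_unique[OF nontriv] by blast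
  with d(1) show False
    by simp
qed

lemma finite_fixed_params: "finite ({0..1} \<inter> fixed_params)"
proof (rule finite_not_islimpt_in_compact)
  fix u assume "u \<in> {0..1::real}"
  show "\<not> u islimpt fixed_params"
    using closed_fixed_params fixed_params_isolated by (auto simp: closed_limpt)
qed simp

text \<open>
A translation by an integer makes the lift fix \<open>s\<close>. Passing to \<open>g \<circ> g\<close> removes the distinction between maps preserving and reversing orientation: it is
increasing and of degree 1 in either case.
\<close>

lemma normalised_lift:
  assumes s: "s \<in> fixed_params"
  obtains g where "lift_of M T g" "continuous_on (pdom M) g" "g s = s"
    "strict_mono_on (pdom M) (\<lambda>v. g (g v))"
    "\<And>v. M = Circle \<Longrightarrow> g (g (v + 1)) = g (g v) + 1"
proof -
  have "diffeomorphism M T"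
    using morse_smale by (simp add: morse_smale_period_one_def)
  from diffeomorphism_monotone_lift[OF this] obtain g where g: "lift_of M T g"
    "continuous_on (pdom M) g" "strict_mono_on (pdom M) g \<or> strict_antimono_on (pdom M) g"
    "M = Circle \<Longrightarrow> \<exists>e. \<bar>e\<bar> = 1 \<and> (\<forall>v. \<forall>n\<in>\<int>. g (v + n) = g v + e * n)"
    by metis
  define c where "c = g s - s"
  have "param M (g s) = param M s"
    using s lift_ofD(2)[OF g(1)] by (auto simp: fixed_params_def fixed_point_def)
  then have c: "if M = Circle then c \<in> \<int> else c = 0"
    by (cases M) (simp_all add: c_def param_Circle_eq_iff del: param.simps(1))
  define f where "f v = g v - c" for v
  have f: "lift_of M T f"
    unfolding lift_of_def
  proof (intro conjI ballI)
    show "f ` pdom M \<subseteq> pdom M"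
      using c lift_ofD(1)[OF g(1)] by (cases M) (auto simp: f_def)
    fix v assume v: "v \<in> pdom M"
    have "param M (f v) = param M (g v)"
      using c by (cases M) (simp_all add: f_def param_Circle_eq_iff del: param.simps(1))
    then show "param M (f v) = T (param M v)"
      using lift_ofD(2)[OF g(1) v] by simp
  qed
  have f_dom: "f v \<in> pdom M" if "v \<in> pdom M" for v
    using lift_ofD(1)[OF f that] .
  have mono: "strict_mono_on (pdom M) (\<lambda>v. f (f v))"
    using g(3)
  proof
    assume "strict_mono_on (pdom M) g"
    then have "strict_mono_on (pdom M) f"
      by (auto simp: strict_mono_on_def f_def)
    then show ?thesis
      using f_dom by (auto simp: strict_mono_on_def)
  next
    assume "strict_antimono_on (pdom M) g"
    then have "strict_antimono_on (pdom M) f"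
      by (auto simp: monotone_on_def f_def)
    then show ?thesis
      using f_dom by (auto simp: monotone_on_def)
  qed
  have shift: "f (f (v + 1)) = f (f v) + 1" if Circle: "M = Circle" for v
  proof -
    obtain e where e: "\<bar>e\<bar> = 1" "\<And>v n. n \<in> \<int> \<Longrightarrow> f (v + n) = f v + e * n"
      using g(4)[OF Circle] by (force simp: f_def)
    then have "e \<in> \<int>" "e * e = 1"
      by (auto simp: abs_if split: if_splits)
    with e(2)[of 1 v] e(2)[of e "f v"] show ?thesis
      by simp
  qed
  have "continuous_on (pdom M) f"
    unfolding f_def by (intro continuous_intros g(2))
  moreover have "f s = s"
    by (simp add: f_def c_def)
  ultimately show ?thesis
    using that[of f] f mono shift by blast
qed

text \<open>
The two ends can only coincide on the circle, when \<open>t = s + 1\<close> and there is one fixed point in all. Then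
\<open>g (g v) - v\<close> vanishes exactly at the integer translates of \<open>s\<close> and, being periodic, has the same sign on both
sides of \<open>s\<close>. So \<open>s\<close> is a local extremum, where the derivative \<open>d\<^sup>2 - 1\<close> vanishes, against
hyperbolicity.
\<close>

lemma consecutive_ends_distinct:
  assumes st: "consecutive_fixed M T s t"
  shows "param M s \<noteq> param M t"
proof
  assume eq: "param M s = param M t"
  have Circle: "M = Circle"
    using eq st by (cases M) (auto simp: consecutive_fixed_def)
  have no_fix: "\<not> fixed_point M T (param M v)" if "v \<in> {s<..<t}" for v
    using st that by (auto simp: consecutive_fixed_def open_arc_def)
  have s: "s \<in> fixed_params"
    using st by (simp add: fixed_params_def consecutive_fixed_def)
  then obtain g where g: "lift_of M T g" "continuous_on (pdom M) g" "g s = s"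
    "strict_mono_on (pdom M) (\<lambda>v. g (g v))"
    and shift: "\<And>v. g (g (v + 1)) = g (g v) + 1"
    using normalised_lift Circle by metis
  have "1 \<le> t - s"
  proof -
    have "t - s \<in> \<int>"
      using eq Circle param_Circle_eq_iff[of t s] by metis
    moreover have "s < t"
      using st by (simp add: consecutive_fixed_def)
    ultimately show ?thesis
      using Ints_nonzero_abs_ge1[of "t - s"] by simp
  qed
  define f where "f v = g (g v) - v" for v
  have cont: "continuous_on A f" for A
    unfolding f_def using g(2) Circle
    by (intro continuous_intros continuous_on_compose2[of UNIV g A g]) (auto intro: continuous_on_subset)
  have "f v \<noteq> 0" if "v \<in> {s<..<s + 1}" for v
  proof
    assume "f v = 0"
    then have "T (T (param M v)) = param M v"
      using lift_ofD(2)[OF g(1)] Circle by (metis UNIV_I eq_iff_diff_eq_0 f_def pdom.simps(1))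
    then have "fixed_point M T (param M v)"
      using Circle by (intro fixed_of_square param_in_pts) auto
    then show False
      using no_fix that \<open>1 \<le> t - s\<close> by auto
  qed
  then have "(\<forall>v\<in>{s<..<s + 1}. 0 < f v) \<or> (\<forall>v\<in>{s<..<s + 1}. f v < 0)"
    using no_zero_constant_sign[OF cont] by blast
  moreover have "f v = f (v + 1)" for v
    by (simp add: f_def shift)
  moreover have "f s = 0"
    by (simp add: f_def g(3))
  ultimately have ext: "(\<forall>v. \<bar>s - v\<bar> < 1 \<longrightarrow> f s \<le> f v) \<or> (\<forall>v. \<bar>s - v\<bar> < 1 \<longrightarrow> f v \<le> f s)"
    by (smt (verit, best) greaterThanLessThan_iff)
  have "s \<in> pdom M" "fixed_point M T (param M s)"
    using s by (auto simp: fixed_params_def)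
  then obtain d where d: "\<bar>d\<bar> \<noteq> 1" "(g has_real_derivative d) (at s within pdom M)"
    using lift_hyperbolic[OF g(1,2)] by blast
  have "(g has_real_derivative d) (at s)"
    using d(2) Circle by simp
  then have "((\<lambda>v. g (g v)) has_real_derivative d * d) (at s)"
    using DERIV_chain2[of g d g s d UNIV] g(3) by simp
  then have "(f has_real_derivative d * d - 1) (at s)"
    unfolding f_def by (intro derivative_intros)
  then have "d * d - 1 = 0"
    using ext DERIV_local_min[of f "d * d - 1" s 1] DERIV_local_max[of f "d * d - 1" s 1] by argo
  then have "d * d = 1"
    by simp
  then have "\<bar>d\<bar> = 1"
    by (auto simp: square_eq_1_iff)
  with d(1) show False
    by simp
qed

lemma T_int_iterate:
  assumes x: "x \<in> pts M"
  shows "int_iterate M T k x \<in> pts M" "T (int_iterate M T k x) = int_iterate M T (k + 1) x"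
proof -
  have img: "T ` pts M = pts M"
    using bij by (simp add: bij_betw_def)
  have T: "(T ^^ n) x \<in> pts M" for n
    by (induction n) (use x img in auto)
  have inv: "(inv_into (pts M) T ^^ n) x \<in> pts M" for n
    by (induction n) (use x img in \<open>auto intro: inv_into_into\<close>)
  show "int_iterate M T k x \<in> pts M"
    using T inv by (simp add: int_iterate_def)
  show "T (int_iterate M T k x) = int_iterate M T (k + 1) x"
  proof (cases "0 \<le> k")
    case True
    then show ?thesis
      by (simp add: int_iterate_def nat_add_distrib)
  next
    case False
    then obtain m where m: "k = - int (Suc m)"
      by (metis int_cases not_le_imp_less of_nat_0_le_iff)
    then show ?thesis
      using f_inv_into_f[of "(inv_into (pts M) T ^^ m) x" T "pts M"] inv[of m] img
      by (auto simp: int_iterate_def nat_add_distrib)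
  qed
qed

text \<open>
A two-sided orbit of the bijection \<open>T\<close> is determined by its value at 0. This identifies integer iterates
without a case distinction on the sign of the exponent.
\<close>

lemma int_iterate_unique:
  assumes "\<And>k. Y k \<in> pts M" "\<And>k. T (Y k) = Y (k + 1)"
  shows "int_iterate M T k (Y 0) = Y k"
proof (induction k rule: int_induct[where k = 0])
  case base
  show ?case
    by (simp add: int_iterate_def)
next
  case (step1 i)
  then show ?case
    using T_int_iterate(2)[OF assms(1), of i 0] assms(2)[of i] by simp
next
  case (step2 i)
  have "T (int_iterate M T (i - 1) (Y 0)) = T (Y (i - 1))"
    using T_int_iterate(2)[OF assms(1), of "i - 1" 0] assms(2)[of "i - 1"] step2 by simp
  then show ?case
    using bij assms(1) T_int_iterate(1)[OF assms(1)] by (auto simp: bij_betw_def inj_on_def)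
qed

lemma int_iterate_add:
  assumes x: "x \<in> pts M"
  shows "int_iterate M T (a + b) x = int_iterate M T a (int_iterate M T b x)"
  using int_iterate_unique[of "\<lambda>k. int_iterate M T (k + b) x" a] T_int_iterate[OF x]
  by (simp add: algebra_simps)

lemma fiber_iterate_eq:
  assumes x: "x \<in> pts M"
  shows "fiber_iterate M T \<Psi> n \<omega> x = int_iterate M T (walk (\<lambda>i. \<Psi> (\<omega> (int i))) n) x"
proof (induction n)
  case 0
  then show ?case
    by (simp add: int_iterate_def)
next
  case (Suc n)
  have "(shift ^^ n) \<omega> i = \<omega> (i + int n)" for i
    by (induction n arbitrary: i) (simp_all add: shift_def algebra_simps)
  then show ?case
    using Suc int_iterate_add[OF x, of "\<Psi> (\<omega> (int n))" "walk (\<lambda>i. \<Psi> (\<omega> (int i))) n"]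
    by (simp add: fiber_map_def walk_def add.commute)
qed

text \<open>
Even and odd iterates of \<open>T\<close> are handled together: if the even ones converge to a fixed point, then so
do their images under \<open>T\<close>.
\<close>

lemma tendsto_alternating_lift:
  assumes g: "lift_of M T g" "continuous_on (pdom M) g" and a: "a \<in> pdom M" "param M (g a) = param M a"
    and X: "X \<longlonglongrightarrow> a" "\<And>n. X n \<in> pdom M" and r: "filterlim r at_top sequentially"
  shows "(\<lambda>n::nat. if P n then param M (X (r n)) else param M (g (X (r n)))) \<longlonglongrightarrow> param M a"
proof -
  have Xr: "(\<lambda>n. X (r n)) \<longlonglongrightarrow> a"
    by (rule filterlim_compose[OF X(1) r])
  then have "(\<lambda>n. g (X (r n))) \<longlonglongrightarrow> g a"
    using X(2) by (intro continuous_on_tendsto_compose[OF g(2) _ a(1)]) auto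
  then have "(\<lambda>n. param M (g (X (r n)))) \<longlonglongrightarrow> param M (g a)"
    by (intro continuous_on_tendsto_compose[OF continuous_on_param[of UNIV]]) auto
  then have "(\<lambda>n. param M (g (X (r n)))) \<longlonglongrightarrow> param M a"
    by (simp only: a(2))
  moreover have "(\<lambda>n. param M (X (r n))) \<longlonglongrightarrow> param M a"
    using Xr by (intro continuous_on_tendsto_compose[OF continuous_on_param[of UNIV]]) auto
  ultimately show ?thesis
    by (intro filterlim_If) (auto intro: tendsto_mono[OF inf_le1])
qed

text \<open>
The increasing map \<open>g \<circ> g\<close> has the two-sided orbit \<open>H\<close> of \<open>u\<close> between \<open>s\<close> and \<open>t\<close>. Interleaving \<open>H\<close>
with its image under \<open>g\<close> gives the orbit of \<open>x\<close> under \<open>T\<close>; when \<open>T\<close> reverses orientation, the odd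
iterates run in the complementary arc, towards the same end points.
\<close>

lemma consecutive_heteroclinic:
  assumes st: "consecutive_fixed M T s t" and x: "x \<in> open_arc M s t"
  shows "x \<in> pts M"
    and "(\<lambda>n. int_iterate M T (int n) x) \<longlonglongrightarrow> param M t \<and>
          (\<lambda>n. int_iterate M T (- int n) x) \<longlonglongrightarrow> param M s \<or>
         (\<lambda>n. int_iterate M T (int n) x) \<longlonglongrightarrow> param M s \<and>
          (\<lambda>n. int_iterate M T (- int n) x) \<longlonglongrightarrow> param M t"
proof -
  have st': "s \<in> pdom M" "t \<in> pdom M" "s < t" "s \<in> fixed_params" "t \<in> fixed_params"
    using st by (auto simp: fixed_params_def consecutive_fixed_def)
  then have sub: "{s..t} \<subseteq> pdom M"
    by (cases M) auto
  have no_fix: "\<not> fixed_point M T (param M v)" if "v \<in> {s<..<t}" for v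
    using st that by (auto simp: consecutive_fixed_def open_arc_def)
  obtain u where u: "u \<in> {s<..<t}" "x = param M u"
    using x by (auto simp: open_arc_def)
  then show "x \<in> pts M"
    using sub by (auto intro!: param_in_pts)
  obtain g where g: "lift_of M T g" "continuous_on (pdom M) g" "g s = s"
    "strict_mono_on (pdom M) (\<lambda>v. g (g v))"
    and shift: "\<And>v. M = Circle \<Longrightarrow> g (g (v + 1)) = g (g v) + 1"
    using normalised_lift[OF st'(4)] by metis
  let ?G = "\<lambda>v. g (g v)"
  have lift2: "param M (?G v) = T (T (param M v))" if "v \<in> pdom M" for v
    using that lift_ofD[OF g(1)] by simp
  have G_t: "?G t = t"
  proof -
    have pt: "param M (?G t) = param M t"
      using lift2[OF st'(2)] st'(5) by (simp add: fixed_params_def fixed_point_def)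
    show ?thesis
    proof (cases M)
      case Interval
      with pt show ?thesis by simp
    next
      case Circle
      \<comment> \<open>otherwise the translate \<open>s + 1\<close> of \<open>s\<close> would be a fixed point inside the arc\<close>
      have "\<not> s + 1 < t"
      proof
        assume "s + 1 < t"
        moreover have "param M (s + 1) = param M s"
          using Circle by (simp only: param_Circle_eq_iff) simp
        ultimately show False
          using no_fix[of "s + 1"] st'(4) by (simp add: fixed_params_def)
      qed
      moreover have "?G s < ?G t"
        using strict_mono_onD[OF g(4)] st' by blast
      moreover have "?G t \<le> ?G (s + 1)"
        using strict_mono_onD[OF g(4), of t "s + 1"] \<open>\<not> s + 1 < t\<close> Circle by (cases "t = s + 1") auto
      ultimately have "\<bar>?G t - t\<bar> < 1"
        using shift[OF Circle, of s] g(3) st'(3) by simp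
      moreover have "?G t - t \<in> \<int>"
        using pt Circle by (simp add: param_Circle_eq_iff del: param.simps)
      ultimately show ?thesis
        using Ints_nonzero_abs_less1 by fastforce
    qed
  qed
  have g_t: "param M (g t) = param M t"
    using lift_ofD(2)[OF g(1) st'(2)] st'(5) by (simp add: fixed_params_def fixed_point_def)
  obtain H :: "int \<Rightarrow> real" where H: "H 0 = u" "\<And>k. H k \<in> {s<..<t}" "\<And>k. ?G (H k) = H (k + 1)"
    "(\<lambda>n. H (int n)) \<longlonglongrightarrow> t \<and> (\<lambda>n. H (- int n)) \<longlonglongrightarrow> s \<or>
     (\<lambda>n. H (int n)) \<longlonglongrightarrow> s \<and> (\<lambda>n. H (- int n)) \<longlonglongrightarrow> t"
  proof (rule monotone_interval_orbit[of s t ?G u])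
    show "continuous_on {s..t} ?G"
      using sub lift_ofD(1)[OF g(1)]
      by (intro continuous_on_compose2[OF g(2)] continuous_on_subset[OF g(2)]) auto
    show "strict_mono_on {s..t} ?G"
      using g(4) sub by (rule monotone_on_subset)
    show "?G s = s"
      by (simp add: g(3))
    show "?G v \<noteq> v" if "v \<in> {s<..<t}" for v
    proof
      assume "?G v = v"
      moreover have "v \<in> pdom M"
        using that sub by auto
      ultimately have "fixed_point M T (param M v)"
        using lift2[of v] by (intro fixed_of_square param_in_pts) auto
      then show False
        using no_fix[OF that] by simp
    qed
  qed (use G_t u in auto)
  have H_dom: "H k \<in> pdom M" for k
    using H(2)[of k] sub by auto
  define Y where "Y k = (if even k then param M (H (k div 2)) else param M (g (H (k div 2))))" for k
  have "int_iterate M T k (Y 0) = Y k" for k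
  proof (rule int_iterate_unique)
    show "Y k \<in> pts M" for k
      using H_dom lift_ofD(1)[OF g(1)] by (auto simp: Y_def intro!: param_in_pts)
    show "T (Y k) = Y (k + 1)" for k
      using lift2[OF H_dom[of "k div 2"]] lift_ofD(2)[OF g(1) H_dom[of "k div 2"]] H(3)[of "k div 2"]
      by (cases "even k") (auto simp: Y_def elim!: oddE)
  qed
  moreover have "Y 0 = x"
    by (simp add: Y_def H(1) u(2))
  ultimately have Y: "int_iterate M T k x = Y k" for k
    by simp
  have g_s: "param M (g s) = param M s"
    by (simp add: g(3))
  have half: "filterlim (\<lambda>n. (n + i) div 2) at_top sequentially" for i :: nat
    unfolding filterlim_at_top
  proof
    show "\<forall>\<^sub>F n in sequentially. Z \<le> (n + i) div 2" for Z
      by (rule eventually_sequentiallyI[of "2 * Z"]) simp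
  qed
  have up: "(\<lambda>n. int_iterate M T (int n) x) \<longlonglongrightarrow> param M a"
    if "(\<lambda>n. H (int n)) \<longlonglongrightarrow> a" "a \<in> pdom M" "param M (g a) = param M a" for a
  proof -
    have "int n div 2 = int ((n + 0) div 2)" for n
      by linarith
    then have "int_iterate M T (int n) x =
        (if even n then param M (H (int ((n + 0) div 2))) else param M (g (H (int ((n + 0) div 2)))))" for n
      by (simp only: Y Y_def even_of_nat)
    then show ?thesis
      using tendsto_alternating_lift[OF g(1,2) that(2,3,1) H_dom half[of 0], of even] by (simp only:)
  qed
  have down: "(\<lambda>n. int_iterate M T (- int n) x) \<longlonglongrightarrow> param M a"
    if "(\<lambda>n. H (- int n)) \<longlonglongrightarrow> a" "a \<in> pdom M" "param M (g a) = param M a" for a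
  proof -
    have "- int n div 2 = - int ((n + 1) div 2)" for n
      by linarith
    then have "int_iterate M T (- int n) x =
        (if even n then param M (H (- int ((n + 1) div 2))) else param M (g (H (- int ((n + 1) div 2)))))" for n
      by (simp only: Y Y_def even_minus even_of_nat)
    then show ?thesis
      using tendsto_alternating_lift[OF g(1,2) that(2,3,1) H_dom half[of 1], of even] by (simp only:)
  qed
  from H(4) up[OF _ st'(1) g_s] up[OF _ st'(2) g_t] down[OF _ st'(1) g_s] down[OF _ st'(2) g_t]
  show "(\<lambda>n. int_iterate M T (int n) x) \<longlonglongrightarrow> param M t \<and>
          (\<lambda>n. int_iterate M T (- int n) x) \<longlonglongrightarrow> param M s \<or>
         (\<lambda>n. int_iterate M T (int n) x) \<longlonglongrightarrow> param M s \<and>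
          (\<lambda>n. int_iterate M T (- int n) x) \<longlonglongrightarrow> param M t"
    by blast
qed

lemma fixed_params_nonempty: "fixed_params \<noteq> {}"
proof -
  obtain x where "fixed_point M T x"
    using morse_smale
    by (auto simp: morse_smale_period_one_def fixed_sink_def fixed_source_def)
  then show ?thesis
    by (auto simp: fixed_params_def fixed_point_def pts_def)
qed

section \<open>Almost every point lies between consecutive fixed points\<close>

text \<open>
On the circle the translates of one fixed point suffice. On the segment \<open>T \<circ> T\<close> is increasing and
onto, so it fixes both end points, which are then fixed by \<open>T\<close>.
\<close>

lemma fixed_params_both_sides:
  assumes u: "u \<in> pdom M"
  obtains a b where "a \<in> fixed_params" "b \<in> fixed_params" "a \<le> u" "u \<le> b"
proof (cases M)
  case Circle
  obtain s where s: "s \<in> fixed_params"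
    using fixed_params_nonempty by auto
  have "s + of_int n \<in> fixed_params" for n
  proof -
    have "param M (s + of_int n) = param M s"
      using Circle by (simp only: param_Circle_eq_iff) simp
    moreover have "s + of_int n \<in> pdom M"
      using Circle by simp
    ultimately show ?thesis
      using s unfolding fixed_params_def by (metis (mono_tags, lifting) mem_Collect_eq)
  qed
  moreover have "s + of_int \<lfloor>u - s\<rfloor> \<le> u" "u \<le> s + of_int \<lceil>u - s\<rceil>"
    by linarith+
  ultimately show ?thesis
    using that by blast
next
  case Interval
  obtain s where "s \<in> fixed_params"
    using fixed_params_nonempty by auto
  then obtain g where g: "lift_of M T g" "strict_mono_on (pdom M) (\<lambda>v. g (g v))"
    using normalised_lift by metis
  have dom: "g v \<in> {0..1}" if "v \<in> {0..1}" for v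
    using lift_ofD(1)[OF g(1)] that Interval by simp
  have onto: "\<exists>v\<in>{0..1}. g (g v) = w" if w: "w \<in> {0..1}" for w
  proof -
    have lift: "\<exists>v\<in>{0..1}. g v = w'" if "w' \<in> {0..1}" for w'
    proof -
      have "complex_of_real w' \<in> T ` pts M"
        using bij that Interval by (auto simp: bij_betw_def pts_def)
      then obtain v where "v \<in> {0..1}" "T (complex_of_real v) = complex_of_real w'"
        using Interval by (auto simp: pts_def)
      then show ?thesis
        using lift_ofD(2)[OF g(1), of v] Interval by auto
    qed
    from lift[OF w] lift show ?thesis
      by metis
  qed
  have mono: "g (g v) \<le> g (g w)" if "v \<in> {0..1}" "w \<in> {0..1}" "v \<le> w" for v w
    using strict_mono_onD[OF g(2), of v w] that Interval by (cases "v = w") auto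
  have "g (g 0) = 0"
    using onto[of 0] mono[of 0] dom[of "g 0"] dom[of 0] by force
  moreover have "g (g 1) = 1"
    using onto[of 1] mono[of _ 1] dom[of "g 1"] dom[of 1] by force
  ultimately have "T (T (param M 0)) = param M 0" "T (T (param M 1)) = param M 1"
    using lift_ofD[OF g(1), of 0] lift_ofD[OF g(1), of 1] lift_ofD(2)[OF g(1), of "g 0"]
      lift_ofD(2)[OF g(1), of "g 1"] Interval by auto
  moreover have "0 \<in> pdom M" "1 \<in> pdom M"
    using Interval by auto
  ultimately have "0 \<in> fixed_params" "1 \<in> fixed_params"
    by (auto simp: fixed_params_def intro!: fixed_of_square param_in_pts)
  then show ?thesis
    using that u Interval by auto
qed

lemma in_consecutive_arc:
  assumes x: "x \<in> pts M" "\<not> fixed_point M T x"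
  obtains s t where "consecutive_fixed M T s t" "x \<in> open_arc M s t"
proof -
  obtain u where u: "u \<in> pdom M" "x = param M u"
    using x(1) by (auto simp: pts_def)
  have u_F: "u \<notin> fixed_params"
    using x(2) u by (simp add: fixed_params_def)
  obtain a b where ab: "a \<in> fixed_params" "b \<in> fixed_params" "a \<le> u" "u \<le> b"
    using fixed_params_both_sides[OF u(1)] by blast
  define L where "L = fixed_params \<inter> {..u}"
  define R where "R = fixed_params \<inter> {u..}"
  have L: "Sup L \<in> L" "bdd_above L"
  proof -
    show "bdd_above L"
      by (auto simp: L_def)
    moreover have "closed L" "L \<noteq> {}"
      using ab closed_fixed_params by (auto simp: L_def)
    ultimately show "Sup L \<in> L"
      by (intro closed_contains_Sup)
  qed
  have R: "Inf R \<in> R" "bdd_below R"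
  proof -
    show "bdd_below R"
      by (auto simp: R_def)
    moreover have "closed R" "R \<noteq> {}"
      using ab closed_fixed_params by (auto simp: R_def)
    ultimately show "Inf R \<in> R"
      by (intro closed_contains_Inf)
  qed
  define s where "s = Sup L"
  define t where "t = Inf R"
  have s: "s \<in> fixed_params" "s < u" and t: "t \<in> fixed_params" "u < t"
    using L(1) R(1) u_F by (auto simp: L_def R_def s_def t_def less_le)
  have gap: "v \<notin> fixed_params" if "s < v" "v < t" for v
  proof
    assume v: "v \<in> fixed_params"
    show False
    proof (cases "v \<le> u")
      case True
      then have "v \<le> s"
        using cSup_upper[OF _ L(2)] v by (simp add: s_def L_def)
      with that show False by simp
    next
      case False
      then have "t \<le> v"
        using cInf_lower[OF _ R(2)] v by (simp add: t_def R_def)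
      with that show False by simp
    qed
  qed
  have "s \<in> pdom M" "t \<in> pdom M"
    using s(1) t(1) by (auto simp: fixed_params_def)
  then have "{s<..<t} \<subseteq> pdom M"
    by (cases M) auto
  then have "\<forall>y\<in>open_arc M s t. \<not> fixed_point M T y"
    using gap by (auto simp: open_arc_def fixed_params_def)
  then have "consecutive_fixed M T s t"
    using s t by (simp add: consecutive_fixed_def fixed_params_def)
  moreover have "x \<in> open_arc M s t"
    using s(2) t(2) u(2) by (auto simp: open_arc_def)
  ultimately show ?thesis
    using that by blast
qed

lemma sigma_finite_Leb: "sigma_finite_measure (Leb M)"
proof -
  have "finite_measure (restrict_space lborel {0..1::real})"
    by (intro finite_measureI) (simp add: emeasure_restrict_space space_restrict_space)
  then have "finite_measure (Leb M)"
    unfolding Leb_def by (rule finite_measure.finite_measure_distr) (rule measurable_param)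
  then show ?thesis
    by (simp add: finite_measure_def)
qed

lemma pts_eq_unit_image: "pts M = param M ` {0..1}"
proof (cases M)
  case Circle
  have "param M u \<in> param M ` {0..1}" for u
  proof (rule image_eqI[of _ _ "frac u"])
    show "param M u = param M (frac u)"
      using Circle by (simp only: param_Circle_eq_iff) (simp add: frac_def)
    show "frac u \<in> {0..1}"
      using frac_lt_1[of u] by simp
  qed
  then show ?thesis
    using Circle by (auto simp: pts_def)
qed (simp add: pts_def)

lemma AE_not_fixed: "AE x in Leb M. x \<in> pts M \<and> \<not> fixed_point M T x"
proof -
  let ?F = "{0..1} \<inter> fixed_params"
  have dom: "u \<in> pdom M" if "u \<in> {0..1}" for u
    using that by (cases M) auto
  have "param M ` ?F = {x \<in> pts M. fixed_point M T x}"
    using dom by (auto simp: pts_eq_unit_image fixed_params_def)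
  moreover have "param M ` ?F \<in> sets borel"
    using finite_fixed_params by (intro borel_closed finite_imp_closed) simp
  ultimately have F: "{x \<in> pts M. fixed_point M T x} \<in> sets (borel_on M)"
    by (auto simp: sets_restrict_space image_iff intro!: bexI[of _ "param M ` ?F"])
  have "AE u in lborel. u \<notin> ?F"
    by (intro AE_not_in finite_imp_null_set_lborel finite_fixed_params)
  then have "AE u in restrict_space lborel {0..1}. \<not> fixed_point M T (param M u)"
    using dom by (subst AE_restrict_space_iff) (auto simp: fixed_params_def elim!: AE_mp)
  then have "AE u in restrict_space lborel {0..1}. param M u \<in> pts M \<and> \<not> fixed_point M T (param M u)"
    using AE_space by eventually_elim (use dom in \<open>auto simp: space_restrict_space intro: param_in_pts\<close>)
  moreover have "{x \<in> space (borel_on M). x \<in> pts M \<and> \<not> fixed_point M T x} =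
      space (borel_on M) - {x \<in> pts M. fixed_point M T x}"
    by (auto simp: space_restrict_space)
  with F have "{x \<in> space (borel_on M). x \<in> pts M \<and> \<not> fixed_point M T x} \<in> sets (borel_on M)"
    by auto
  ultimately show ?thesis
    unfolding Leb_def by (subst AE_distr_iff[OF measurable_param])
qed

end

section \<open>Historical behavior and the limit measures\<close>

lemma bernoulli_steps_distr:
  fixes P :: "'a pmf" and \<Psi> :: "'a \<Rightarrow> int"
  defines "W \<equiv> \<Pi>\<^sub>M i\<in>(UNIV :: nat set). measure_pmf (map_pmf \<Psi> P)"
  shows "(\<lambda>\<omega> i. \<Psi> (\<omega> (int i))) \<in> bernoulli_measure P \<rightarrow>\<^sub>M W"
    and "distr (bernoulli_measure P) W (\<lambda>\<omega> i. \<Psi> (\<omega> (int i))) = W"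
proof -
  interpret sequence_space "measure_pmf P"
    by unfold_locales
  let ?Q = "measure_pmf (map_pmf \<Psi> P)"
  let ?r = "\<lambda>\<omega>::int \<Rightarrow> 'a. \<lambda>i. \<omega> (int i)" and ?g = "\<lambda>\<omega>::nat \<Rightarrow> 'a. \<lambda>i. \<Psi> (\<omega> i)"
  have r: "?r \<in> bernoulli_measure P \<rightarrow>\<^sub>M S"
    unfolding bernoulli_measure_def
    by (rule measurable_PiM_single') (auto intro!: measurable_component_singleton)
  have r_distr: "distr (bernoulli_measure P) S ?r = S"
    using distr_PiM_reindex[of UNIV "\<lambda>_. measure_pmf P" int UNIV]
    by (simp add: bernoulli_measure_def measure_pmf.prob_space_axioms restrict_UNIV)
  have coord: "(\<lambda>\<omega>. \<omega> i) \<in> S \<rightarrow>\<^sub>M measure_pmf P" for i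
    by (rule measurable_component_singleton) simp
  have \<Psi>: "\<Psi> \<in> measure_pmf P \<rightarrow>\<^sub>M ?Q"
    by simp
  have gi: "(\<lambda>\<omega>. \<Psi> (\<omega> i)) \<in> S \<rightarrow>\<^sub>M ?Q" for i
    by (rule measurable_compose[OF coord \<Psi>])
  then have g: "?g \<in> S \<rightarrow>\<^sub>M W"
    unfolding W_def by (intro measurable_PiM_single') auto
  have gi_distr: "distr S ?Q (\<lambda>\<omega>. \<Psi> (\<omega> i)) = ?Q" for i
  proof -
    have "distr S ?Q (\<lambda>\<omega>. \<Psi> (\<omega> i)) = distr (distr S (measure_pmf P) (\<lambda>\<omega>. \<omega> i)) ?Q \<Psi>"
      by (subst distr_distr[OF \<Psi> coord]) (simp add: comp_def)
    also have "distr S (measure_pmf P) (\<lambda>\<omega>. \<omega> i) = measure_pmf P"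
      by (rule PiM_component) simp
    also have "distr (measure_pmf P) ?Q \<Psi> = distr (measure_pmf P) (count_space UNIV) \<Psi>"
      by (intro distr_cong) auto
    also have "\<dots> = ?Q"
      by (simp add: map_pmf_rep_eq)
    finally show ?thesis .
  qed
  have "P.indep_vars (\<lambda>_. ?Q) (\<lambda>i \<omega>. \<Psi> (\<omega> i)) UNIV"
    using P.indep_vars_compose2[OF indep_coords, of "\<lambda>_. \<Psi>" "\<lambda>_. ?Q"] by simp
  then have g_distr: "distr S W ?g = W"
    using gi by (subst (asm) P.indep_vars_iff_distr_eq_PiM') (simp_all add: gi_distr W_def restrict_UNIV)
  let ?f = "\<lambda>\<omega> i. \<Psi> (\<omega> (int i))"
  show "?f \<in> bernoulli_measure P \<rightarrow>\<^sub>M W"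
    using measurable_compose[OF r g] .
  have "distr (bernoulli_measure P) W ?f = distr (distr (bernoulli_measure P) S ?r) W ?g"
    by (subst distr_distr[OF g r]) (simp add: comp_def)
  then show "distr (bernoulli_measure P) W ?f = W"
    by (simp add: r_distr g_distr)
qed

lemma AE_bernoulli_steps:
  fixes P :: "'a pmf" and \<Psi> :: "'a \<Rightarrow> int"
  assumes "AE \<omega> in \<Pi>\<^sub>M i\<in>(UNIV :: nat set). measure_pmf (map_pmf \<Psi> P). R \<omega>"
  shows "AE \<omega> in bernoulli_measure P. R (\<lambda>i. \<Psi> (\<omega> (int i)))"
  using AE_distrD[OF bernoulli_steps_distr(1)[of \<Psi> P], of R] assms
  by (simp only: bernoulli_steps_distr(2)[of P \<Psi>])

text \<open>
The time spent below 0 is the time spent above 0 by the reflected walk, whose steps are again centred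
with the same variance.
\<close>

lemma AE_oscillating:
  fixes P :: "'a pmf" and \<Psi> :: "'a \<Rightarrow> int"
  assumes mean: "(\<integral>a. real_of_int (\<Psi> a) \<partial>P) = 0"
    and int: "integrable P (\<lambda>a. (real_of_int (\<Psi> a))\<^sup>2)"
    and var: "0 < (\<integral>a. (real_of_int (\<Psi> a))\<^sup>2 \<partial>P)"
  shows "AE \<omega> in bernoulli_measure P. oscillating (walk (\<lambda>i. \<Psi> (\<omega> (int i))))"
proof -
  define \<sigma> where "\<sigma> = sqrt (\<integral>a. (real_of_int (\<Psi> a))\<^sup>2 \<partial>P)"
  have up: "int_random_walk (map_pmf \<Psi> P) \<sigma>"
    using assms by unfold_locales (simp_all add: \<sigma>_def integrable_map_pmf_eq)
  have down: "int_random_walk (map_pmf (\<lambda>a. - \<Psi> a) P) \<sigma>"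
    using assms by unfold_locales (simp_all add: \<sigma>_def integrable_map_pmf_eq)
  have neg: "visits (walk (\<lambda>i. - \<omega> i)) {0<..} n = visits (walk \<omega>) {..<0} n" for \<omega> n
    by (simp add: visits_def walk_def sum_negf)
  have "AE \<omega> in bernoulli_measure P. \<forall>k::int. \<forall>m::nat. \<forall>\<^sub>F n in sequentially.
      real (visits (walk (\<lambda>i. \<Psi> (\<omega> (int i)))) {k} n) \<le> 1 / Suc m * n"
    by (rule AE_bernoulli_steps, unfold AE_all_countable,
        intro allI int_random_walk.eventually_visits_le[OF up]) simp
  moreover have "AE \<omega> in bernoulli_measure P. \<forall>e::real. 0 < e \<longrightarrow>
      (\<exists>\<^sub>F n in sequentially. (1 - e) * n \<le> visits (walk (\<lambda>i. \<Psi> (\<omega> (int i)))) {0<..} n)"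
    by (rule AE_bernoulli_steps[OF int_random_walk.frequently_visits_positive[OF up]])
  moreover have "AE \<omega> in bernoulli_measure P. \<forall>e::real. 0 < e \<longrightarrow>
      (\<exists>\<^sub>F n in sequentially. (1 - e) * n \<le> visits (walk (\<lambda>i. \<Psi> (\<omega> (int i)))) {..<0} n)"
    using AE_bernoulli_steps[OF int_random_walk.frequently_visits_positive[OF down]] by (simp add: neg)
  ultimately show ?thesis
  proof eventually_elim
    case (elim \<omega>)
    let ?v = "\<lambda>k n. real (visits (walk (\<lambda>i. \<Psi> (\<omega> (int i)))) {k} n) / n"
    have "?v k \<longlonglongrightarrow> 0" for k
    proof (rule LIMSEQ_I)
      fix r :: real assume "0 < r"
      then obtain m where m: "1 / Suc m < r"
        using reals_Archimedean by (auto simp: inverse_eq_divide)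
      have "\<forall>\<^sub>F n in sequentially. ?v k n \<le> 1 / Suc m"
        using elim(1)[rule_format, of k m] eventually_gt_at_top[of 0]
        by eventually_elim (simp add: divide_le_eq)
      then have "\<forall>\<^sub>F n in sequentially. norm (?v k n - 0) < r"
        by eventually_elim (use m in auto)
      then show "\<exists>N. \<forall>n\<ge>N. norm (?v k n - 0) < r"
        by (simp add: eventually_sequentially)
    qed
    with elim(2,3) show ?case
      unfolding oscillating_def by blast
  qed
qed

lemma AE_pair_of_AE:
  assumes \<nu>: "sigma_finite_measure \<nu>" and A: "AE x in \<mu>. A x" and B: "AE y in \<nu>. B y"
  shows "AE z in \<mu> \<Otimes>\<^sub>M \<nu>. A (fst z) \<and> B (snd z)"
proof -
  interpret sigma_finite_measure \<nu> by fact
  obtain N1 where N1: "N1 \<in> null_sets \<mu>" "{x \<in> space \<mu>. \<not> A x} \<subseteq> N1"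
    using A by (auto simp: eventually_ae_filter)
  obtain N2 where N2: "N2 \<in> null_sets \<nu>" "{y \<in> space \<nu>. \<not> B y} \<subseteq> N2"
    using B by (auto simp: eventually_ae_filter)
  have "N1 \<times> space \<nu> \<union> space \<mu> \<times> N2 \<in> null_sets (\<mu> \<Otimes>\<^sub>M \<nu>)"
    using N1(1) N2(1) by (intro null_sets.Un times_in_null_sets1 times_in_null_sets2) auto
  moreover have "{z \<in> space (\<mu> \<Otimes>\<^sub>M \<nu>). \<not> (A (fst z) \<and> B (snd z))} \<subseteq> N1 \<times> space \<nu> \<union> space \<mu> \<times> N2"
    using N1(2) N2(2) by (auto simp: space_pair_measure)
  ultimately show ?thesis
    by (rule AE_I')
qed

lemma convex_comb_swap:
  "convex_comb l (dirac M p) (dirac M q) = convex_comb (1 - l) (dirac M q) (dirac M p)"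
  by (simp add: convex_comb_def dirac_def add.commute)

lemma convex_comb_set_swap:
  "{convex_comb l (dirac M p) (dirac M q) | l. l \<in> {0..1}} =
   {convex_comb l (dirac M q) (dirac M p) | l. l \<in> {0..1}}"
proof -
  have "{convex_comb l (dirac M p) (dirac M q) | l. l \<in> {0..1}} \<subseteq>
      {convex_comb l (dirac M q) (dirac M p) | l. l \<in> {0..1}}" for p q
  proof
    fix \<mu> assume "\<mu> \<in> {convex_comb l (dirac M p) (dirac M q) | l. l \<in> {0..1}}"
    then obtain l where "l \<in> {0..1}" "\<mu> = convex_comb (1 - l) (dirac M q) (dirac M p)"
      using convex_comb_swap by blast
    then show "\<mu> \<in> {convex_comb l (dirac M q) (dirac M p) | l. l \<in> {0..1}}"
      by (intro CollectI exI[of _ "1 - l"]) auto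
  qed
  then show ?thesis
    by blast
qed

context morse_smale
begin

lemma heteroclinic_historical_and_limits:
  assumes osc: "oscillating (walk (\<lambda>i. \<Psi> (\<omega> (int i))))"
    and x: "x \<in> pts M" and pq: "p \<in> pts M" "q \<in> pts M" "p \<noteq> q"
    and up: "(\<lambda>n. int_iterate M T (int n) x) \<longlonglongrightarrow> q"
    and down: "(\<lambda>n. int_iterate M T (- int n) x) \<longlonglongrightarrow> p"
  shows "historical_at M T \<Psi> \<omega> x"
    and "limit_measures M T \<Psi> \<omega> x = {convex_comb l (dirac M q) (dirac M p) | l. l \<in> {0..1}}"
proof -
  let ?S = "walk (\<lambda>i. \<Psi> (\<omega> (int i)))"
  have orbit: "fiber_iterate M T \<Psi> n \<omega> x = int_iterate M T (?S n) x" for n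
    by (rule fiber_iterate_eq[OF x])
  have lim: "(\<lambda>n. \<phi> (int_iterate M T (int n) x)) \<longlonglongrightarrow> \<phi> q"
    "(\<lambda>n. \<phi> (int_iterate M T (- int n) x)) \<longlonglongrightarrow> \<phi> p"
    if "continuous_on (pts M) \<phi>" for \<phi> :: "complex \<Rightarrow> real"
    using T_int_iterate(1)[OF x] pq(1,2)
    by (auto intro!: continuous_on_tendsto_compose[OF that] up down)
  have "continuous_on (pts M) (\<lambda>z. dist z p)"
    by (intro continuous_intros)
  moreover from time_average_not_convergent[OF osc lim[OF this]]
  have "\<not> convergent (time_average (\<lambda>j. dist (int_iterate M T (?S j) x) p))"
    using pq(3) by simp
  ultimately show "historical_at M T \<Psi> \<omega> x"
    unfolding historical_at_def orbit time_average_def by blast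
  show "limit_measures M T \<Psi> \<omega> x = {convex_comb l (dirac M q) (dirac M p) | l. l \<in> {0..1}}"
    unfolding limit_measures_def orbit
  proof (rule empirical_limit_points[OF pq])
    show "(\<lambda>n. time_average (\<lambda>j. \<phi> (int_iterate M T (?S j) x)) n -
        (\<phi> p + pos_fraction ?S n * (\<phi> q - \<phi> p))) \<longlonglongrightarrow> 0"
      if "continuous_on (pts M) \<phi>" for \<phi> :: "complex \<Rightarrow> real"
      using time_average_two_limits[OF osc lim[OF that]] .
  qed (use T_int_iterate(1)[OF x] pos_fraction_bounds frequently_pos_fraction_near[OF osc] in auto)
qed

lemma consecutive_historical_and_limits:
  assumes osc: "oscillating (walk (\<lambda>i. \<Psi> (\<omega> (int i))))"
    and st: "consecutive_fixed M T s t" and x: "x \<in> open_arc M s t"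
  shows "historical_at M T \<Psi> \<omega> x"
    and "limit_measures M T \<Psi> \<omega> x =
      {convex_comb l (dirac M (param M s)) (dirac M (param M t)) | l. l \<in> {0..1}}"
proof -
  have pts: "param M s \<in> pts M" "param M t \<in> pts M"
    using st by (auto simp: consecutive_fixed_def intro: param_in_pts)
  note ne = consecutive_ends_distinct[OF st] consecutive_ends_distinct[OF st, symmetric]
  note * = heteroclinic_historical_and_limits[of \<Psi> \<omega>, OF osc consecutive_heteroclinic(1)[OF st x]]
  from consecutive_heteroclinic(2)[OF st x]
  have "historical_at M T \<Psi> \<omega> x \<and> limit_measures M T \<Psi> \<omega> x =
      {convex_comb l (dirac M (param M s)) (dirac M (param M t)) | l. l \<in> {0..1}}"
  proof (elim disjE conjE)
    assume "(\<lambda>n. int_iterate M T (int n) x) \<longlonglongrightarrow> param M t"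
      "(\<lambda>n. int_iterate M T (- int n) x) \<longlonglongrightarrow> param M s"
    from *[OF pts ne(1) this] show ?thesis
      by (simp only: convex_comb_set_swap[of M "param M s"] simp_thms)
  next
    assume "(\<lambda>n. int_iterate M T (int n) x) \<longlonglongrightarrow> param M s"
      "(\<lambda>n. int_iterate M T (- int n) x) \<longlonglongrightarrow> param M t"
    from *[OF pts(2,1) ne(2) this] show ?thesis
      by simp
  qed
  then show "historical_at M T \<Psi> \<omega> x" "limit_measures M T \<Psi> \<omega> x =
      {convex_comb l (dirac M (param M s)) (dirac M (param M t)) | l. l \<in> {0..1}}"
    by auto
qed

end

theorem corollary5:
  fixes M :: one_manifold
    and T :: "complex \<Rightarrow> complex"
    and P :: "'a::countable pmf"
    and \<Psi> :: "'a \<Rightarrow> int"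
  assumes "morse_smale_period_one M T"
    and "set_pmf P = UNIV"
    and "(\<integral>\<omega>. real_of_int (\<Psi> (\<omega> 0)) \<partial>bernoulli_measure P) = 0"
    and "integrable (bernoulli_measure P) (\<lambda>\<omega>. (real_of_int (\<Psi> (\<omega> 0)))\<^sup>2)"
    and "0 < (\<integral>\<omega>. (real_of_int (\<Psi> (\<omega> 0)))\<^sup>2 \<partial>bernoulli_measure P)"
  shows "(AE (\<omega>, x) in bernoulli_measure P \<Otimes>\<^sub>M Leb M. historical_at M T \<Psi> \<omega> x) \<and>
    (\<forall>s t. consecutive_fixed M T s t \<longrightarrow>
      (AE \<omega> in bernoulli_measure P. \<forall>x\<in>open_arc M s t.
        limit_measures M T \<Psi> \<omega> x =
          {convex_comb l (dirac M (param M s)) (dirac M (param M t)) | l. l \<in> {0..1}}))"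
proof -
  interpret morse_smale M T
    by unfold_locales fact
  have coord: "(\<lambda>\<omega>. \<omega> 0) \<in> bernoulli_measure P \<rightarrow>\<^sub>M measure_pmf P"
    unfolding bernoulli_measure_def by (rule measurable_component_singleton) simp
  have distr: "distr (bernoulli_measure P) (measure_pmf P) (\<lambda>\<omega>. \<omega> 0) = measure_pmf P"
    unfolding bernoulli_measure_def
    by (rule distr_PiM_component) (auto intro: measure_pmf.prob_space_axioms)
  have E: "(\<integral>\<omega>. f (\<omega> 0) \<partial>bernoulli_measure P) = (\<integral>a. f a \<partial>P)"
    and I: "integrable (bernoulli_measure P) (\<lambda>\<omega>. f (\<omega> 0)) = integrable P f" for f :: "'a \<Rightarrow> real"
    using integral_distr[OF coord, of f] integrable_distr_eq[OF coord, of f] by (simp_all add: distr)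
  have osc: "AE \<omega> in bernoulli_measure P. oscillating (walk (\<lambda>i. \<Psi> (\<omega> (int i))))"
    using assms(3-5) E[of "\<lambda>a. real_of_int (\<Psi> a)"] E[of "\<lambda>a. (real_of_int (\<Psi> a))\<^sup>2"]
      I[of "\<lambda>a. (real_of_int (\<Psi> a))\<^sup>2"]
    by (intro AE_oscillating) simp_all
  show ?thesis
  proof (intro conjI allI impI)
    from AE_pair_of_AE[OF sigma_finite_Leb osc AE_not_fixed]
    show "AE (\<omega>, x) in bernoulli_measure P \<Otimes>\<^sub>M Leb M. historical_at M T \<Psi> \<omega> x"
    proof eventually_elim
      case (elim z)
      then obtain s t where "consecutive_fixed M T s t" "snd z \<in> open_arc M s t"
        using in_consecutive_arc by blast
      then show ?case
        using elim consecutive_historical_and_limits(1)[of \<Psi> "fst z" s t "snd z"]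
        by (simp add: case_prod_beta)
    qed
    fix s t assume st: "consecutive_fixed M T s t"
    show "AE \<omega> in bernoulli_measure P. \<forall>x\<in>open_arc M s t. limit_measures M T \<Psi> \<omega> x =
        {convex_comb l (dirac M (param M s)) (dirac M (param M t)) | l. l \<in> {0..1}}"
      using osc by eventually_elim (use consecutive_historical_and_limits(2)[of \<Psi> _ s t] st in blast)
  qed
qed

end
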